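(* Let $\mathcal{M}=(U,\mathcal{I})$ be a matroid accessed in the dynamic-rank-oracle model, let $s,t\notin U$ be two distinguished symbols, and let $\beta\ge 1$ be an integer. There exists a data structure supporting the following operations (all times count both running time and dynamic-oracle operations): - $\textsc{Initialize}(\mathcal{M},S,Q_S,X)$: given $S\in\mathcal{I}$, a query-set $Q_S$ equal to $S$, and $X$ with either $X\subseteq U\setminus S$, or $X\subseteq S$, or $X=\{t\}$, initialize in $\tilde O(|X|)$ time; the structure maintains $S$. - $\textsc{Find}(y)$: in the case $X\subseteq U\setminus S$, given $y\in S\cup\{s\}$: if $y\in S$ return some $x\in X$ with $S-y+x\in\mathcal{I}$, and if $y=s$ return some $x\in X$ with $S+x\in\mathcal{I}$. In the cases $X\subseteq S$ or $X=\{t\}$, given $y\in U\setminus S$: if $X\subseteq S$ return some $x\in X$ with $S-x+y\in\mathcal{I}$, and if $X=\{t\}$ return $t$ if $S+y\in\mathcal{I}$ and $\bot$ otherwise. The procedure returns $\bot$ if no such $x$ exists; it takes $\tilde O(\beta)$ time if the result is not $\bot$ and $\tilde O(1)$ time otherwise. - $\textsc{Delete}(x)$: given $x\in X$ with $x\notin\{s,t\}$, delete $x$ from $X$ in $O(\log n)$ time. - $\textsc{Replace}(x,y)$: given $x\in X$ and $y\notin X$, replace $x$ by $y$ in $X$ in $O(\log n)$ time. - $\textsc{Update}(\Delta)$: update $S$ to $S\oplus(\Delta\setminus\{s,t\})$ in amortized $\tilde O\!\left(\frac{|X|\cdot|\Delta|}{\beta}\right)$ time (it is assumed the updated $S$ remains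 independent).
   Context: Dynamic-rank-oracle model for $\mathcal{M}$: starting from $S_0=\emptyset$ and counter $k=0$, an algorithm may perform $\textsc{Insert}(v,i)$ (create $S_{k+1}:=S_i\cup\{v\}$, increment $k$), $\textsc{Delete}(v,i)$ (create $S_{k+1}:=S_i\setminus\{v\}$, increment $k$), and $\textsc{Query}(i)$ (return the rank of $S_i$), where $i$ may index any previously created set; the created sets $S_i$ are called query-sets. $n=|U|$, $\oplus$ denotes symmetric difference, $S-y+x$ means $(S\setminus\{y\})\cup\{x\}$, and $\tilde O$ hides polylogarithmic factors in $n$.
   Formalization: Update is shown in amortized Õ(|X||Δ|/β + |Δ| + 1) time: the stated bound fails when |X| is far below β, since Δ must at least be read; for |X| ≥ β and Δ nonempty it is the stated bound. Initialize takes Õ(|X|+1), to cover empty X. *)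

theory Defs
  imports Complex_Main
begin

section \<open>Matroids\<close>

definition matroid :: "'a set \<Rightarrow> 'a set set \<Rightarrow> bool" where
  "matroid U I \<longleftrightarrow>
     finite U \<and> I \<subseteq> Pow U \<and> {} \<in> I \<and>
     (\<forall>A\<in>I. \<forall>B. B \<subseteq> A \<longrightarrow> B \<in> I) \<and>
     (\<forall>A\<in>I. \<forall>B\<in>I. card A < card B \<longrightarrow> (\<exists>x\<in>B - A. insert x A \<in> I))"

definition matroid_rank :: "'a set set \<Rightarrow> 'a set \<Rightarrow> nat" where
  "matroid_rank I A = Max (card ` {B \<in> I. B \<subseteq> A})"


section \<open>Unit-cost random access machines with a dynamic rank oracle\<close>

text \<open>
  Programs are those of a unit-cost random access machine whose only arithmetic is addition and
  truncated subtraction. Memory consists of registers and of statically named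
  arrays, all unbounded. Elements of the ground set are natural numbers, so that they fit into
  memory cells; no relation between these numbers and the size of the ground set is assumed.
  The field \<open>qsets\<close> is the list of the query-sets created so far, the \<open>i\<close>-th entry being the
  query-set with index \<open>i\<close>. A program can access the matroid only by \<open>OInsert\<close>,
  \<open>ODelete\<close> and \<open>OQuery\<close>.
\<close>

record ram =
  reg :: "nat \<Rightarrow> nat"
  arr :: "nat \<Rightarrow> nat \<Rightarrow> nat"
  qsets :: "nat set list"

datatype com =
    Skip
  | Const nat nat
  | Copy nat nat
  | Add nat nat nat
  | Sub nat nat nat
  | Load nat nat nat
  | Store nat nat nat
  | OInsert nat nat nat
  | ODelete nat nat nat
  | OQuery nat nat
  | Seq com com
  | If_Less nat nat com com
  | While_Less nat nat com

abbreviation set_reg :: "nat \<Rightarrow> nat \<Rightarrow> ram \<Rightarrow> ram" where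
  "set_reg r k \<sigma> \<equiv> \<sigma>\<lparr>reg := (reg \<sigma>)(r := k)\<rparr>"

abbreviation set_arr :: "nat \<Rightarrow> nat \<Rightarrow> nat \<Rightarrow> ram \<Rightarrow> ram" where
  "set_arr a j k \<sigma> \<equiv> \<sigma>\<lparr>arr := (arr \<sigma>)(a := (arr \<sigma> a)(j := k))\<rparr>"

abbreviation add_qset :: "nat set \<Rightarrow> ram \<Rightarrow> ram" where
  "add_qset A \<sigma> \<equiv> \<sigma>\<lparr>qsets := qsets \<sigma> @ [A]\<rparr>"

text \<open>
  \<open>exec U I p \<sigma> m \<sigma>'\<close>: started in \<open>\<sigma>\<close>, the program \<open>p\<close> halts in \<open>\<sigma>'\<close> after exactly \<open>m\<close> steps, where
  every elementary instruction, every evaluation of a branching condition and every oracle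
  operation is one step. An oracle operation on an element outside \<open>U\<close> or on an
  index that does not exist yet blocks the machine.
\<close>

inductive exec :: "nat set \<Rightarrow> nat set set \<Rightarrow> com \<Rightarrow> ram \<Rightarrow> nat \<Rightarrow> ram \<Rightarrow> bool" for U I where
  Skip: "exec U I Skip \<sigma> 1 \<sigma>"
| Const: "exec U I (Const r k) \<sigma> 1 (set_reg r k \<sigma>)"
| Copy: "exec U I (Copy r a) \<sigma> 1 (set_reg r (reg \<sigma> a) \<sigma>)"
| Add: "exec U I (Add r a b) \<sigma> 1 (set_reg r (reg \<sigma> a + reg \<sigma> b) \<sigma>)"
| Sub: "exec U I (Sub r a b) \<sigma> 1 (set_reg r (reg \<sigma> a - reg \<sigma> b) \<sigma>)"
| Load: "exec U I (Load r a j) \<sigma> 1 (set_reg r (arr \<sigma> a (reg \<sigma> j)) \<sigma>)"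
| Store: "exec U I (Store a j r) \<sigma> 1 (set_arr a (reg \<sigma> j) (reg \<sigma> r) \<sigma>)"
| OInsert: "reg \<sigma> v \<in> U \<Longrightarrow> reg \<sigma> i < length (qsets \<sigma>) \<Longrightarrow>
    exec U I (OInsert r v i) \<sigma> 1
      (set_reg r (length (qsets \<sigma>)) (add_qset (qsets \<sigma> ! reg \<sigma> i \<union> {reg \<sigma> v}) \<sigma>))"
| ODelete: "reg \<sigma> v \<in> U \<Longrightarrow> reg \<sigma> i < length (qsets \<sigma>) \<Longrightarrow>
    exec U I (ODelete r v i) \<sigma> 1
      (set_reg r (length (qsets \<sigma>)) (add_qset (qsets \<sigma> ! reg \<sigma> i - {reg \<sigma> v}) \<sigma>))"
| OQuery: "reg \<sigma> i < length (qsets \<sigma>) \<Longrightarrow>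
    exec U I (OQuery r i) \<sigma> 1 (set_reg r (matroid_rank I (qsets \<sigma> ! reg \<sigma> i)) \<sigma>)"
| Seq: "exec U I p \<sigma> m \<sigma>' \<Longrightarrow> exec U I q \<sigma>' m' \<sigma>'' \<Longrightarrow> exec U I (Seq p q) \<sigma> (m + m') \<sigma>''"
| If_True: "reg \<sigma> a < reg \<sigma> b \<Longrightarrow> exec U I p \<sigma> m \<sigma>' \<Longrightarrow>
    exec U I (If_Less a b p q) \<sigma> (1 + m) \<sigma>'"
| If_False: "\<not> reg \<sigma> a < reg \<sigma> b \<Longrightarrow> exec U I q \<sigma> m \<sigma>' \<Longrightarrow>
    exec U I (If_Less a b p q) \<sigma> (1 + m) \<sigma>'"
| While_False: "\<not> reg \<sigma> a < reg \<sigma> b \<Longrightarrow> exec U I (While_Less a b p) \<sigma> 1 \<sigma>"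
| While_True: "reg \<sigma> a < reg \<sigma> b \<Longrightarrow> exec U I p \<sigma> m \<sigma>' \<Longrightarrow>
    exec U I (While_Less a b p) \<sigma>' m' \<sigma>'' \<Longrightarrow>
    exec U I (While_Less a b p) \<sigma> (1 + m + m') \<sigma>''"

inductive_cases exec_elims:
  "exec U I Skip \<sigma> m \<sigma>'"
  "exec U I (Const r k) \<sigma> m \<sigma>'"
  "exec U I (Copy r a) \<sigma> m \<sigma>'"
  "exec U I (Add r a b) \<sigma> m \<sigma>'"
  "exec U I (Sub r a b) \<sigma> m \<sigma>'"
  "exec U I (Load r a j) \<sigma> m \<sigma>'"
  "exec U I (Store a j r) \<sigma> m \<sigma>'"
  "exec U I (OInsert r v i) \<sigma> m \<sigma>'"
  "exec U I (ODelete r v i) \<sigma> m \<sigma>'"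
  "exec U I (OQuery r i) \<sigma> m \<sigma>'"
  "exec U I (Seq p q) \<sigma> m \<sigma>'"
  "exec U I (If_Less a b p q) \<sigma> m \<sigma>'"
  "exec U I (While_Less a b p) \<sigma> m \<sigma>'"

lemma exec_deterministic:
  "exec U I p \<sigma> m \<sigma>' \<Longrightarrow> exec U I p \<sigma> k \<tau> \<Longrightarrow> k = m \<and> \<tau> = \<sigma>'"
proof (induction arbitrary: k \<tau> rule: exec.induct)
  case (Seq p \<sigma> m \<sigma>' q m' \<sigma>'')
  from Seq.prems show ?case
    by (rule exec_elims(11)) (metis Seq.IH)
next
  case (If_True \<sigma> a b p m \<sigma>' q)
  from If_True.prems show ?case
    by (rule exec_elims(12)) (use If_True.hyps If_True.IH in force)+
next
  case (If_False \<sigma> a b q m \<sigma>' p)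
  from If_False.prems show ?case
    by (rule exec_elims(12)) (use If_False.hyps If_False.IH in force)+
next
  case (While_False \<sigma> a b p)
  from While_False.prems show ?case
    by (rule exec_elims(13)) (use While_False.hyps in simp_all)
next
  case (While_True \<sigma> a b p m \<sigma>' m' \<sigma>'')
  from While_True.prems show ?case
  proof (rule exec_elims(13))
    fix m1 \<sigma>1 m2
    assume *: "k = Suc (m1 + m2)" "exec U I p \<sigma> m1 \<sigma>1" "exec U I (While_Less a b p) \<sigma>1 m2 \<tau>"
    from While_True.IH(1)[OF *(2)] have "m1 = m" "\<sigma>1 = \<sigma>'" by simp_all
    with While_True.IH(2)[of m2 \<tau>] * show ?thesis by simp
  qed (use While_True.hyps in simp)
qed (erule exec_elims, simp)+

text \<open>\<open>oracle_extends U H H'\<close>: some sequence of oracle insertions and deletions leads from the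
  query-sets \<open>H\<close> to the query-sets \<open>H'\<close>.\<close>

inductive oracle_extends :: "nat set \<Rightarrow> nat set list \<Rightarrow> nat set list \<Rightarrow> bool" for U H where
  refl: "oracle_extends U H H"
| ins: "oracle_extends U H H' \<Longrightarrow> v \<in> U \<Longrightarrow> i < length H' \<Longrightarrow>
    oracle_extends U H (H' @ [H' ! i \<union> {v}])"
| del: "oracle_extends U H H' \<Longrightarrow> v \<in> U \<Longrightarrow> i < length H' \<Longrightarrow>
    oracle_extends U H (H' @ [H' ! i - {v}])"


section \<open>The data structure\<close>

text \<open>
  Calling conventions. A data structure consists of one program per operation. The caller
  puts scalar arguments into registers 0 and 1; a set argument is passed as a duplicate-free list,
  its length in register 0 and its entries in array 1. All other memory is zero at the start of
  \<open>Initialize\<close> and is afterwards left as it is between operations. The set \<open>S\<close> is handed over in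
  array 0, as a table of its characteristic function (it is thus passed by reference and
  need not be read), and the index of \<open>Q\<^sub>S\<close> in register 1. A call of \<open>Find\<close> answers \<open>\<bottom>\<close> by leaving
  0 in register 0, and otherwise leaves the answer in register 1.
\<close>

datatype operation = Find nat | Delete nat | Replace nat nat | Update "nat list"

record data_structure =
  init_code :: com
  find_code :: com
  delete_code :: com
  replace_code :: com
  update_code :: com

fun op_code :: "data_structure \<Rightarrow> operation \<Rightarrow> com" where
  "op_code D (Find y) = find_code D"
| "op_code D (Delete x) = delete_code D"
| "op_code D (Replace x y) = replace_code D"
| "op_code D (Update ds) = update_code D"

definition init_state :: "nat set \<Rightarrow> nat \<Rightarrow> nat list \<Rightarrow> nat set list \<Rightarrow> ram" where
  "init_state S q xs H =
     \<lparr>reg = (\<lambda>_. 0)(0 := length xs, 1 := q),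
      arr = (\<lambda>_ _. 0)(0 := (\<lambda>v. of_bool (v \<in> S)),
                      1 := (\<lambda>j. if j < length xs then xs ! j else 0)),
      qsets = H\<rparr>"

fun load_args :: "operation \<Rightarrow> ram \<Rightarrow> ram" where
  "load_args (Find y) \<sigma> = set_reg 0 y \<sigma>"
| "load_args (Delete x) \<sigma> = set_reg 0 x \<sigma>"
| "load_args (Replace x y) \<sigma> = set_reg 1 y (set_reg 0 x \<sigma>)"
| "load_args (Update ds) \<sigma> =
     set_reg 0 (length ds)
       (\<sigma>\<lparr>arr := (arr \<sigma>)(1 := (\<lambda>j. if j < length ds then ds ! j else arr \<sigma> 1 j))\<rparr>)"

definition find_answer :: "ram \<Rightarrow> nat option" where
  "find_answer \<sigma> = (if reg \<sigma> 0 = 0 then None else Some (reg \<sigma> 1))"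

text \<open>The structure keeps \<open>S\<close> in the form in which it was handed over: the table in array 0 and,
  in register 2, the index of a query-set equal to \<open>S\<close>.\<close>

definition maintains :: "nat set \<Rightarrow> ram \<Rightarrow> bool" where
  "maintains S \<sigma> \<longleftrightarrow>
     (\<forall>v. arr \<sigma> 0 v = of_bool (v \<in> S)) \<and>
     reg \<sigma> 2 < length (qsets \<sigma>) \<and> qsets \<sigma> ! reg \<sigma> 2 = S"

definition valid_init ::
  "nat set \<Rightarrow> nat set set \<Rightarrow> nat \<Rightarrow> nat set \<Rightarrow> nat \<Rightarrow> nat set \<Rightarrow> nat list \<Rightarrow> nat set list \<Rightarrow> bool" where
  "valid_init U I t S q X xs H \<longleftrightarrow>
     S \<in> I \<and>
     oracle_extends U [{}] H \<and> q < length H \<and> H ! q = S \<and>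
     (X \<subseteq> U - S \<or> X \<subseteq> S \<or> X = {t}) \<and>
     distinct xs \<and> set xs = X"

fun valid_op ::
  "nat set \<Rightarrow> nat set set \<Rightarrow> nat \<Rightarrow> nat \<Rightarrow> nat set \<Rightarrow> nat set \<Rightarrow> operation \<Rightarrow> bool" where
  "valid_op U I s t S X (Find y) \<longleftrightarrow>
     X \<subseteq> U - S \<and> y \<in> S \<union> {s} \<or>
     (X \<subseteq> S \<or> X = {t}) \<and> y \<in> U - S"
| "valid_op U I s t S X (Delete x) \<longleftrightarrow> x \<in> X \<and> x \<notin> {s, t}"
| "valid_op U I s t S X (Replace x y) \<longleftrightarrow> x \<in> X \<and> y \<in> U \<union> {s, t} \<and> y \<notin> X"
| "valid_op U I s t S X (Update ds) \<longleftrightarrow>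
     distinct ds \<and> set ds \<subseteq> U \<union> {s, t} \<and> sym_diff S (set ds - {s, t}) \<in> I"

fun next_S :: "nat \<Rightarrow> nat \<Rightarrow> nat set \<Rightarrow> operation \<Rightarrow> nat set" where
  "next_S s t S (Update ds) = sym_diff S (set ds - {s, t})"
| "next_S s t S _ = S"

fun next_X :: "nat set \<Rightarrow> operation \<Rightarrow> nat set" where
  "next_X X (Delete x) = X - {x}"
| "next_X X (Replace x y) = X - {x} \<union> {y}"
| "next_X X _ = X"

definition find_results ::
  "nat set set \<Rightarrow> nat \<Rightarrow> nat \<Rightarrow> nat set \<Rightarrow> nat set \<Rightarrow> nat \<Rightarrow> nat set" where
  "find_results I s t S X y =
     (if y = s then {x \<in> X. S \<union> {x} \<in> I}
      else if y \<in> S then {x \<in> X. S - {y} \<union> {x} \<in> I}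
      else if X = {t} then (if S \<union> {y} \<in> I then {t} else {})
      else {x \<in> X. S - {x} \<union> {y} \<in> I})"

text \<open>
  \<open>session U I s t D S X \<sigma> tr\<close>: after \<open>Initialize\<close> and some sequence of operations, each
  called with admissible arguments, the machine is in state \<open>\<sigma>\<close> and the two sets have
  become \<open>S\<close> and \<open>X\<close>. The trace \<open>tr\<close> lists the operations performed after \<open>Initialize\<close>, each with
  the value of \<open>card X\<close> at the time of the call and the number of steps used. By rule \<open>caller\<close>, the
  oracle is shared with the caller, who may create further query-sets between two operations.
\<close>

inductive session ::
  "nat set \<Rightarrow> nat set set \<Rightarrow> nat \<Rightarrow> nat \<Rightarrow> data_structure \<Rightarrow>
   nat set \<Rightarrow> nat set \<Rightarrow> ram \<Rightarrow> (operation \<times> nat \<times> nat) list \<Rightarrow> bool"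
  for U I s t D where
  start: "valid_init U I t S q X xs H \<Longrightarrow>
    exec U I (init_code D) (init_state S q xs H) m \<sigma> \<Longrightarrow>
    session U I s t D S X \<sigma> []"
| operation: "session U I s t D S X \<sigma> tr \<Longrightarrow> valid_op U I s t S X f \<Longrightarrow>
    exec U I (op_code D f) (load_args f \<sigma>) m \<sigma>' \<Longrightarrow>
    session U I s t D (next_S s t S f) (next_X X f) \<sigma>' (tr @ [(f, card X, m)])"
| caller: "session U I s t D S X \<sigma> tr \<Longrightarrow> oracle_extends U (qsets \<sigma>) H \<Longrightarrow>
    session U I s t D S X (\<sigma>\<lparr>qsets := H\<rparr>) tr"

definition total_update_time :: "(operation \<times> nat \<times> nat) list \<Rightarrow> nat" where
  "total_update_time tr =
     (\<Sum>(f, k, m)\<leftarrow>tr. case f of Update ds \<Rightarrow> m | _ \<Rightarrow> 0)"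

text \<open>The summand \<open>length ds + 1\<close> is the cost of making the call and reading its argument. It is
  dominated by the first summand (and 1) as long as \<open>\<beta> \<le> card X\<close>, but it cannot be dropped if
  \<open>card X\<close> is small compared to \<open>\<beta>\<close>.\<close>

definition total_update_budget :: "nat \<Rightarrow> (operation \<times> nat \<times> nat) list \<Rightarrow> real" where
  "total_update_budget \<beta> tr =
     (\<Sum>(f, k, m)\<leftarrow>tr. case f of
        Update ds \<Rightarrow> real k * real (length ds) / real \<beta> + (real (length ds) + 1) | _ \<Rightarrow> 0)"

text \<open>The shift by 2 makes the logarithm at least 1 also for ground sets of size 0 and 1.\<close>

definition lg :: "nat \<Rightarrow> real" where
  "lg n = log 2 (real n + 2)"

end

theory Submission
  imports Defs
begin

text \<open>
  The elements of \<open>X\<close> are the nodes of a binary heap, stored in an array, and every node \<open>v\<close> carries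
  the query-set \<open>S \<oplus> X\<^sub>v\<close>, where \<open>X\<^sub>v\<close> is the part of \<open>X\<close> in the subtree of \<open>v\<close>. This is \<open>S \<union> X\<^sub>v\<close> if
  \<open>X\<close> is disjoint from \<open>S\<close> and \<open>S - X\<^sub>v\<close> if \<open>X \<subseteq> S\<close>; in both cases a comparison of two ranks
  decides whether the subtree contains an answer to \<open>Find\<close>, so that an answer is found by descending
  from the root. \<open>Replace\<close> changes the query-sets on one path, \<open>Delete\<close> moves the last heap
  element into the hole. \<open>Update\<close> corrects only the root and logs the toggled elements; \<open>Find\<close>
  applies the log to the few nodes that it visits below the root, and as soon as the log has length
  \<open>\<beta>\<close>, all nodes are rebuilt. As the root is exact, \<open>\<bottom>\<close> is answered in constant time.
\<close>

section \<open>Paths in a binary heap\<close>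

text \<open>Toggling one element of \<open>S\<close> changes the correct query-set of every heap
  node, which is too much work for each update. Errors below the root are therefore tolerated, but
  confined to logged elements. They are repaired from the current table and positions by overwriting
  memberships, so order and repetitions in the log do not matter, and \<open>Replace\<close> and
  \<open>Delete\<close> may run between two rebuildings without enlarging the set of possible
  errors. The invariant is phrased with symmetric differences because \<open>Replace\<close> and
  \<open>Update\<close> may leave \<open>X\<close> partly inside \<open>S\<close>; one of the
  admissible shapes of \<open>X\<close> is assumed only when \<open>Find\<close> is called. The two
  kinds of rank test rest on different facts: for candidates outside \<open>S\<close> on the
  augmentation axiom, for candidates inside \<open>S\<close> on the fact that \<open>y\<close> can
  replace a nonempty set \<open>Y\<close> iff it can replace a single element of \<open>Y\<close>. A
  successful \<open>Find\<close> visits O(lg n) nodes and treats fewer than \<open>\<beta>\<close>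
  log entries at each of them, with a climb of O(lg n) levels per entry. This is the origin of the
  factor \<open>\<beta>\<close> and of the exponent 2 of the logarithm.\<close>

fun anc :: "nat \<Rightarrow> nat set" where
  "anc p = (if p = 0 then {} else insert p (anc (p div 2)))"

text \<open>This is the bit length of \<open>p\<close>, and also the number of nodes in
  \<open>anc p\<close>: each step towards the root drops one binary digit.\<close>

fun bits :: "nat \<Rightarrow> nat" where
  "bits p = (if p = 0 then 0 else Suc (bits (p div 2)))"

declare anc.simps [simp del] bits.simps [simp del]

lemma anc_0 [simp]: "anc 0 = {}"
  by (simp add: anc.simps)

lemma anc_pos: "0 < p \<Longrightarrow> anc p = insert p (anc (p div 2))"
  by (simp add: anc.simps)

lemma bits_0 [simp]: "bits 0 = 0"
  by (simp add: bits.simps)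

lemma bits_pos: "0 < p \<Longrightarrow> bits p = Suc (bits (p div 2))"
  by (simp add: bits.simps)

lemma anc_bounds: "v \<in> anc p \<Longrightarrow> 1 \<le> v \<and> v \<le> p"
proof (induction p rule: less_induct)
  case (less p)
  then have "0 < p" by (cases p) auto
  with less.prems show ?case
    using less.IH[of "p div 2"] by (fastforce simp: anc_pos)
qed

lemma self_in_anc: "0 < p \<Longrightarrow> p \<in> anc p"
  by (simp add: anc_pos)

lemma root_in_anc_iff: "Suc 0 \<in> anc p \<longleftrightarrow> 0 < p"
proof (induction p rule: less_induct)
  case (less p)
  show ?case
  proof (cases "p \<le> 1")
    case True
    then show ?thesis by (cases p) (auto simp: anc_pos)
  next
    case False
    then show ?thesis using less[of "p div 2"] by (auto simp: anc_pos)
  qed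
qed

text \<open>A path that passes \<open>v\<close> without starting there enters it from one of the two
  children. Hence \<open>Find\<close> loses no candidate except the one at \<open>v\<close> itself
  when it replaces a node by its children.\<close>

lemma anc_children:
  assumes "1 \<le> v"
  shows "v \<in> anc p \<longleftrightarrow> p = v \<or> 2 * v \<in> anc p \<or> Suc (2 * v) \<in> anc p"
proof (induction p rule: less_induct)
  case (less p)
  show ?case
  proof (cases "p = 0")
    case False
    then have "v \<in> anc (p div 2) \<longleftrightarrow>
        p div 2 = v \<or> 2 * v \<in> anc (p div 2) \<or> Suc (2 * v) \<in> anc (p div 2)"
      by (intro less) simp
    moreover have "p div 2 = v \<longleftrightarrow> p = 2 * v \<or> p = Suc (2 * v)"
      by presburger
    ultimately show ?thesis using False by (auto simp: anc_pos)
  qed (use assms in auto)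
qed

lemma bits_mono: "p \<le> q \<Longrightarrow> bits p \<le> bits q"
proof (induction q arbitrary: p rule: less_induct)
  case (less q)
  show ?case
  proof (cases "p = 0")
    case False
    with less.prems less.IH[of "q div 2" "p div 2"] show ?thesis
      by (simp add: bits_pos div_le_mono)
  qed simp
qed

lemma bits_children: "1 \<le> v \<Longrightarrow> bits (2 * v) = Suc (bits v) \<and> bits (Suc (2 * v)) = Suc (bits v)"
  by (simp add: bits_pos[of "2 * v"] bits_pos[of "Suc (2 * v)"])

lemma two_power_bits_le: "0 < p \<Longrightarrow> 2 ^ bits p \<le> 2 * p"
proof (induction p rule: less_induct)
  case (less p)
  show ?case
  proof (cases "p div 2 = 0")
    case True
    with less.prems show ?thesis by (simp add: bits_pos)
  next
    case False
    with less.prems have "2 ^ bits (p div 2) \<le> 2 * (p div 2)"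
      by (intro less.IH) auto
    with less.prems show ?thesis by (simp add: bits_pos)
  qed
qed

section \<open>Height of the heap and the logarithm of the ground set size\<close>

lemma lg_ge_1: "1 \<le> lg n"
  by (simp add: lg_def)

text \<open>The bound \<open>n + 2\<close> fits the heap: \<open>X\<close> may contain
  \<open>s\<close> and \<open>t\<close> besides elements of \<open>U\<close>.\<close>

lemma bits_le_lg:
  assumes "p \<le> n + 2"
  shows "real (bits p) \<le> 1 + lg n"
proof (cases "p = 0")
  case True
  then show ?thesis using lg_ge_1[of n] by simp
next
  case False
  have "real (2 ^ bits p) \<le> 2 * real p"
    using two_power_bits_le[of p] False by (metis of_nat_le_iff of_nat_mult of_nat_numeral not_gr0)
  also have "\<dots> \<le> 2 * (real n + 2)"
    using assms by simp
  finally have "log 2 (2 ^ bits p) \<le> log 2 (2 * (real n + 2))"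
    by (subst log_le_cancel_iff) auto
  also have "\<dots> = 1 + log 2 (real n + 2)"
    by (subst log_mult) auto
  finally show ?thesis by (simp add: lg_def)
qed


section \<open>Rank and exchange in matroids\<close>

lemma matroid_finite_indep: "matroid U I \<Longrightarrow> A \<in> I \<Longrightarrow> finite A"
  by (auto simp: matroid_def intro: finite_subset)

lemma matroid_subset_indep: "matroid U I \<Longrightarrow> A \<in> I \<Longrightarrow> B \<subseteq> A \<Longrightarrow> B \<in> I"
  by (auto simp: matroid_def)

lemma matroid_augment:
  "matroid U I \<Longrightarrow> A \<in> I \<Longrightarrow> B \<in> I \<Longrightarrow> card A < card B \<Longrightarrow> \<exists>x\<in>B - A. insert x A \<in> I"
  by (simp add: matroid_def)

lemma finite_indep_subsets: "matroid U I \<Longrightarrow> finite {B \<in> I. B \<subseteq> A}"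
  by (rule finite_subset[of _ "Pow U"]) (auto simp: matroid_def)

lemma rank_attained:
  assumes "matroid U I"
  obtains B where "B \<in> I" "B \<subseteq> A" "card B = matroid_rank I A"
proof -
  have "matroid_rank I A \<in> card ` {B \<in> I. B \<subseteq> A}"
    unfolding matroid_rank_def using assms
    by (intro Max_in) (auto simp: finite_indep_subsets[OF assms] matroid_def)
  then show ?thesis using that by auto
qed

lemma card_le_rank: "matroid U I \<Longrightarrow> B \<in> I \<Longrightarrow> B \<subseteq> A \<Longrightarrow> card B \<le> matroid_rank I A"
  unfolding matroid_rank_def by (intro Max_ge) (auto simp: finite_indep_subsets)

lemma rank_indep:
  assumes "matroid U I" "A \<in> I"
  shows "matroid_rank I A = card A"
proof (rule antisym)
  obtain B where "B \<in> I" "B \<subseteq> A" "card B = matroid_rank I A"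
    using rank_attained[OF assms(1)] .
  then show "matroid_rank I A \<le> card A"
    using card_mono[of A B] matroid_finite_indep[OF assms] by simp
qed (use card_le_rank assms in blast)

text \<open>If \<open>B\<close> has larger rank, a largest independent subset of \<open>B\<close>
  augments \<open>A\<close>. A single comparison of ranks thus tests all candidates in
  \<open>B - A\<close> at once.\<close>

lemma rank_less_iff:
  assumes M: "matroid U I" and A: "A \<in> I" and AB: "A \<subseteq> B"
  shows "matroid_rank I A < matroid_rank I B \<longleftrightarrow> (\<exists>x\<in>B - A. insert x A \<in> I)"
proof
  assume less: "matroid_rank I A < matroid_rank I B"
  obtain B' where B': "B' \<in> I" "B' \<subseteq> B" "card B' = matroid_rank I B"
    using rank_attained[OF M] .
  with less have "card A < card B'" by (simp add: rank_indep[OF M A])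
  with M A B'(1) have "\<exists>x\<in>B' - A. insert x A \<in> I" by (intro matroid_augment)
  with B'(2) show "\<exists>x\<in>B - A. insert x A \<in> I" by blast
next
  assume "\<exists>x\<in>B - A. insert x A \<in> I"
  then obtain x where x: "x \<in> B - A" "insert x A \<in> I" by blast
  then have "card (insert x A) \<le> matroid_rank I B"
    using AB by (intro card_le_rank[OF M]) auto
  with x show "matroid_rank I A < matroid_rank I B"
    by (simp add: rank_indep[OF M A] matroid_finite_indep[OF M A])
qed

text \<open>Augment \<open>A\<close> from \<open>B\<close> until the sizes agree; the induction is
  on the remaining gap.\<close>

lemma matroid_extend:
  assumes M: "matroid U I" and "A \<in> I" "B \<in> I" "card A \<le> card B"
  shows "\<exists>C\<in>I. A \<subseteq> C \<and> C \<subseteq> A \<union> B \<and> card C = card B"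
  using assms(2,4)
proof (induction "card B - card A" arbitrary: A)
  case 0
  then show ?case by (intro bexI[of _ A]) auto
next
  case (Suc k)
  then have "card A < card B" by simp
  then obtain x where x: "x \<in> B - A" "insert x A \<in> I"
    using matroid_augment[OF M Suc.prems(1) assms(3)] by blast
  have "card (insert x A) = Suc (card A)"
    using x matroid_finite_indep[OF M Suc.prems(1)] by simp
  then have "k = card B - card (insert x A)" "card (insert x A) \<le> card B"
    using Suc.hyps(2) \<open>card A < card B\<close> by auto
  then obtain C where "C \<in> I" "insert x A \<subseteq> C" "C \<subseteq> insert x A \<union> B" "card C = card B"
    using Suc.hyps(1)[OF _ x(2)] by blast
  then show ?case using x(1) by (intro bexI[of _ C]) auto
qed

text \<open>Extend \<open>S - Y + y\<close> by elements of \<open>S\<close> to the size of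
  \<open>S\<close>. The result misses exactly one element of \<open>S\<close>, and that element lies
  in \<open>Y\<close>, since the rest of \<open>S\<close> was kept. As \<open>Y\<close> is nonempty,
  \<open>S - Y + y\<close> is not larger than \<open>S\<close>, so the extension exists.\<close>

lemma exchange_iff:
  assumes M: "matroid U I" and S: "S \<in> I" and Y: "Y \<subseteq> S" "Y \<noteq> {}" and y: "y \<notin> S"
  shows "insert y (S - Y) \<in> I \<longleftrightarrow> (\<exists>x\<in>Y. insert y (S - {x}) \<in> I)"
proof
  assume ind: "insert y (S - Y) \<in> I"
  note fin = matroid_finite_indep[OF M]
  have "card (S - Y) < card S"
    using Y fin[OF S] by (intro psubset_card_mono) auto
  then have "card (insert y (S - Y)) \<le> card S"
    using fin[OF S] by (simp add: card_insert_if)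
  then obtain B where B: "B \<in> I" "insert y (S - Y) \<subseteq> B" "B \<subseteq> insert y S" "card B = card S"
    using matroid_extend[OF M ind S] by auto
  have "\<not> S \<subseteq> B"
  proof
    assume "S \<subseteq> B"
    with B have "insert y S \<subseteq> B" by auto
    then have "card (insert y S) \<le> card B" using fin[OF B(1)] by (intro card_mono)
    with B(4) y fin[OF S] show False by simp
  qed
  then obtain x where x: "x \<in> S" "x \<notin> B" by blast
  have "card (insert y (S - {x})) = Suc (card (S - {x}))"
    using y fin[OF S] by simp
  also have "\<dots> = card S"
    using x(1) fin[OF S] by (intro card_Suc_Diff1)
  finally have cc: "card (insert y (S - {x})) = card S" .
  have sub: "B \<subseteq> insert y (S - {x})" using B x by auto
  have "B = insert y (S - {x})"
    using card_subset_eq[OF _ sub] cc B(4) fin[OF S] by simp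
  moreover have "x \<in> Y" using x B by auto
  ultimately show "\<exists>x\<in>Y. insert y (S - {x}) \<in> I" using B(1) by blast
next
  assume "\<exists>x\<in>Y. insert y (S - {x}) \<in> I"
  then obtain x where "x \<in> Y" "insert y (S - {x}) \<in> I" by blast
  then show "insert y (S - Y) \<in> I"
    by (elim matroid_subset_indep[OF M]) auto
qed


section \<open>Weakest preconditions with step counts\<close>

text \<open>Total correctness, with the number of steps passed to the postcondition: time bounds and
  functional claims come out of the same symbolic execution.\<close>

definition wp :: "nat set \<Rightarrow> nat set set \<Rightarrow> com \<Rightarrow> ram \<Rightarrow> (nat \<Rightarrow> ram \<Rightarrow> bool) \<Rightarrow> bool" where
  "wp U I p \<sigma> Q \<longleftrightarrow> (\<exists>m \<sigma>'. exec U I p \<sigma> m \<sigma>' \<and> Q m \<sigma>')"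

text \<open>Keeps the simplifier from rewriting the postcondition before the program has been executed
  symbolically.\<close>

lemma wp_weak_cong [cong]: "p = p' \<Longrightarrow> \<sigma> = \<sigma>' \<Longrightarrow> wp U I p \<sigma> Q = wp U I p' \<sigma>' Q"
  by simp

lemma wp_mono: "wp U I p \<sigma> Q \<Longrightarrow> (\<And>m \<sigma>'. Q m \<sigma>' \<Longrightarrow> R m \<sigma>') \<Longrightarrow> wp U I p \<sigma> R"
  unfolding wp_def by blast

text \<open>Determinism makes this an equivalence. It serves as a rewrite rule for elementary
  instructions, and it later turns a specification into a statement about the particular run
  recorded in a session.\<close>

lemma wp_exec: "exec U I p \<sigma> m \<tau> \<Longrightarrow> wp U I p \<sigma> Q \<longleftrightarrow> Q m \<tau>"
  unfolding wp_def by (blast dest: exec_deterministic)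

lemmas wp_elementary [simp] =
  wp_exec[OF exec.Skip] wp_exec[OF exec.Const] wp_exec[OF exec.Copy] wp_exec[OF exec.Add]
  wp_exec[OF exec.Sub] wp_exec[OF exec.Load] wp_exec[OF exec.Store]

lemma wp_oracle [simp]:
  "wp U I (OInsert r v i) \<sigma> Q \<longleftrightarrow> reg \<sigma> v \<in> U \<and> reg \<sigma> i < length (qsets \<sigma>) \<and>
     Q 1 (set_reg r (length (qsets \<sigma>)) (add_qset (qsets \<sigma> ! reg \<sigma> i \<union> {reg \<sigma> v}) \<sigma>))"
  "wp U I (ODelete r v i) \<sigma> Q \<longleftrightarrow> reg \<sigma> v \<in> U \<and> reg \<sigma> i < length (qsets \<sigma>) \<and>
     Q 1 (set_reg r (length (qsets \<sigma>)) (add_qset (qsets \<sigma> ! reg \<sigma> i - {reg \<sigma> v}) \<sigma>))"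
  "wp U I (OQuery r i) \<sigma> Q \<longleftrightarrow> reg \<sigma> i < length (qsets \<sigma>) \<and>
     Q 1 (set_reg r (matroid_rank I (qsets \<sigma> ! reg \<sigma> i)) \<sigma>)"
proof -
  show "wp U I (OInsert r v i) \<sigma> Q \<longleftrightarrow> reg \<sigma> v \<in> U \<and> reg \<sigma> i < length (qsets \<sigma>) \<and>
     Q 1 (set_reg r (length (qsets \<sigma>)) (add_qset (qsets \<sigma> ! reg \<sigma> i \<union> {reg \<sigma> v}) \<sigma>))"
    by (cases "reg \<sigma> v \<in> U \<and> reg \<sigma> i < length (qsets \<sigma>)")
      (use wp_exec[OF exec.OInsert] in blast, auto simp: wp_def elim: exec_elims(8))
  show "wp U I (ODelete r v i) \<sigma> Q \<longleftrightarrow> reg \<sigma> v \<in> U \<and> reg \<sigma> i < length (qsets \<sigma>) \<and>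
     Q 1 (set_reg r (length (qsets \<sigma>)) (add_qset (qsets \<sigma> ! reg \<sigma> i - {reg \<sigma> v}) \<sigma>))"
    by (cases "reg \<sigma> v \<in> U \<and> reg \<sigma> i < length (qsets \<sigma>)")
      (use wp_exec[OF exec.ODelete] in blast, auto simp: wp_def elim: exec_elims(9))
  show "wp U I (OQuery r i) \<sigma> Q \<longleftrightarrow> reg \<sigma> i < length (qsets \<sigma>) \<and>
     Q 1 (set_reg r (matroid_rank I (qsets \<sigma> ! reg \<sigma> i)) \<sigma>)"
    by (cases "reg \<sigma> i < length (qsets \<sigma>)")
      (use wp_exec[OF exec.OQuery] in blast, auto simp: wp_def elim: exec_elims(10))
qed

lemma wp_Seq [simp]:
  "wp U I (Seq p q) \<sigma> Q \<longleftrightarrow> wp U I p \<sigma> (\<lambda>m \<sigma>'. wp U I q \<sigma>' (\<lambda>m'. Q (m + m')))"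
proof
  assume "wp U I (Seq p q) \<sigma> Q"
  then show "wp U I p \<sigma> (\<lambda>m \<sigma>'. wp U I q \<sigma>' (\<lambda>m'. Q (m + m')))"
    unfolding wp_def by (blast elim: exec_elims(11))
next
  assume "wp U I p \<sigma> (\<lambda>m \<sigma>'. wp U I q \<sigma>' (\<lambda>m'. Q (m + m')))"
  then show "wp U I (Seq p q) \<sigma> Q"
    unfolding wp_def by (blast intro: exec.Seq)
qed

lemma wp_If [simp]:
  "wp U I (If_Less a b p q) \<sigma> Q \<longleftrightarrow>
     (if reg \<sigma> a < reg \<sigma> b then wp U I p \<sigma> (\<lambda>m. Q (Suc m)) else wp U I q \<sigma> (\<lambda>m. Q (Suc m)))"
  (is "?l \<longleftrightarrow> ?r")
proof
  assume ?l
  then show ?r unfolding wp_def by (auto elim!: exec_elims(12))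
next
  assume r: ?r
  show ?l
  proof (cases "reg \<sigma> a < reg \<sigma> b")
    case True
    with r obtain m \<sigma>' where "exec U I p \<sigma> m \<sigma>'" "Q (Suc m) \<sigma>'"
      unfolding wp_def by auto
    with exec.If_True[OF True this(1), of q] show ?thesis unfolding wp_def by auto
  next
    case False
    with r obtain m \<sigma>' where "exec U I q \<sigma> m \<sigma>'" "Q (Suc m) \<sigma>'"
      unfolding wp_def by auto
    with exec.If_False[OF False this(1), of p] show ?thesis unfolding wp_def by auto
  qed
qed

lemma wp_While_iff:
  "wp U I (While_Less a b p) \<sigma> Q \<longleftrightarrow>
     (if reg \<sigma> a < reg \<sigma> b
      then wp U I p \<sigma> (\<lambda>m \<sigma>'. wp U I (While_Less a b p) \<sigma>' (\<lambda>m'. Q (Suc (m + m'))))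
      else Q 1 \<sigma>)"
  (is "?l \<longleftrightarrow> ?r")
proof
  assume ?l
  then obtain m \<sigma>' where "exec U I (While_Less a b p) \<sigma> m \<sigma>'" "Q m \<sigma>'"
    unfolding wp_def by blast
  then show ?r unfolding wp_def by (auto elim!: exec_elims(13)[of U I a b p \<sigma> m \<sigma>'])
next
  assume r: ?r
  show ?l
  proof (cases "reg \<sigma> a < reg \<sigma> b")
    case True
    with r obtain m \<sigma>' m' \<sigma>'' where "exec U I p \<sigma> m \<sigma>'"
      "exec U I (While_Less a b p) \<sigma>' m' \<sigma>''" "Q (Suc (m + m')) \<sigma>''"
      unfolding wp_def by auto
    with exec.While_True[OF True this(1,2)] show ?thesis unfolding wp_def by auto
  next
    case False
    with r exec.While_False[OF False] show ?thesis unfolding wp_def by (meson)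
  qed
qed

text \<open>The variant \<open>k\<close> bounds the number of remaining iterations. Each of them
  costs one test and at most \<open>T\<close> steps; the outer \<open>Suc\<close> pays for the final
  failing test.\<close>

lemma wp_While:
  assumes step: "\<And>k \<sigma>. Inv k \<sigma> \<Longrightarrow> reg \<sigma> a < reg \<sigma> b \<Longrightarrow>
      wp U I p \<sigma> (\<lambda>m \<sigma>'. m \<le> T \<and> (\<exists>k'<k. Inv k' \<sigma>'))"
    and "Inv k \<sigma>"
  shows "wp U I (While_Less a b p) \<sigma>
      (\<lambda>m \<sigma>'. m \<le> Suc (k * Suc T) \<and> \<not> reg \<sigma>' a < reg \<sigma>' b \<and> (\<exists>k'. Inv k' \<sigma>'))"
  using assms(2)
proof (induction k arbitrary: \<sigma> rule: less_induct)
  case (less k)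
  show ?case
  proof (cases "reg \<sigma> a < reg \<sigma> b")
    case True
    have "wp U I p \<sigma> (\<lambda>m \<sigma>'. wp U I (While_Less a b p) \<sigma>' (\<lambda>m' \<sigma>''.
        Suc (m + m') \<le> Suc (k * Suc T) \<and> \<not> reg \<sigma>'' a < reg \<sigma>'' b \<and> (\<exists>k'. Inv k' \<sigma>'')))"
    proof (rule wp_mono[OF step[OF less.prems True]])
      fix m \<sigma>'
      assume "m \<le> T \<and> (\<exists>k'<k. Inv k' \<sigma>')"
      then obtain k' where m: "m \<le> T" and k': "k' < k" "Inv k' \<sigma>'" by blast
      have "Suc k' * Suc T \<le> k * Suc T" using k'(1) by (intro mult_le_mono1) simp
      with m have "Suc (m + m') \<le> Suc (k * Suc T)" if "m' \<le> Suc (k' * Suc T)" for m'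
        using that by simp
      then show "wp U I (While_Less a b p) \<sigma>' (\<lambda>m' \<sigma>''.
          Suc (m + m') \<le> Suc (k * Suc T) \<and> \<not> reg \<sigma>'' a < reg \<sigma>'' b \<and> (\<exists>k'. Inv k' \<sigma>''))"
        by (intro wp_mono[OF less.IH[OF k']]) blast
    qed
    with True show ?thesis by (subst wp_While_iff) simp
  next
    case False
    with less.prems show ?thesis by (subst wp_While_iff) auto
  qed
qed

section \<open>The programs\<close>

text \<open>
  Register 2 holds the index of the query-set \<open>S\<close>, array 0 its table and array 1 the argument
  list, as prescribed by the calling conventions. Array \<open>aSlot\<close> maps the heap positions
  \<open>1, \<dots>, rN\<close> to the elements of \<open>X\<close> and \<open>aPos\<close> is its inverse, with value 0 outside \<open>X\<close>. As there
  is no division, \<open>aPar\<close> tabulates \<open>\<lambda>j. j div 2\<close>. Array \<open>aQ\<close> holds the query-set indices of the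
  nodes, and the first \<open>rD\<close> entries of \<open>aD\<close> are the log of toggled elements.
\<close>

abbreviation (input) rN :: nat where "rN \<equiv> 3"
abbreviation (input) rD :: nat where "rD \<equiv> 4"
abbreviation (input) rZ :: nat where "rZ \<equiv> 5"
abbreviation (input) rOne :: nat where "rOne \<equiv> 6"
abbreviation (input) rX :: nat where "rX \<equiv> 7"
abbreviation (input) rB :: nat where "rB \<equiv> 8"
abbreviation (input) rV :: nat where "rV \<equiv> 9"
abbreviation (input) rI :: nat where "rI \<equiv> 10"
abbreviation (input) rP :: nat where "rP \<equiv> 11"
abbreviation (input) rT :: nat where "rT \<equiv> 12"
abbreviation (input) rY :: nat where "rY \<equiv> 13"
abbreviation (input) rC :: nat where "rC \<equiv> 14"
abbreviation (input) rG :: nat where "rG \<equiv> 15"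
abbreviation (input) rL :: nat where "rL \<equiv> 16"
abbreviation (input) rR :: nat where "rR \<equiv> 17"

abbreviation (input) aSlot :: nat where "aSlot \<equiv> 2"
abbreviation (input) aPos :: nat where "aPos \<equiv> 3"
abbreviation (input) aPar :: nat where "aPar \<equiv> 4"
abbreviation (input) aQ :: nat where "aQ \<equiv> 5"
abbreviation (input) aD :: nat where "aD \<equiv> 6"

abbreviation seq (infixr ";;" 60) where "p ;; q \<equiv> Seq p q"

abbreviation If_Eq :: "nat \<Rightarrow> nat \<Rightarrow> com \<Rightarrow> com \<Rightarrow> com" where
  "If_Eq a b p q \<equiv> If_Less a b q (If_Less b a q p)"

definition consts_code :: com where
  "consts_code = (Const rZ 0 ;; Const rOne 1)"

text \<open>Membership is set to the value of \<open>rB\<close> instead of being toggled, so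
  treating an element that occurs several times in the log is harmless.\<close>

definition member_code :: "nat \<Rightarrow> com" where
  "member_code r = If_Less rZ rB (OInsert r rX r) (ODelete r rX r)"

text \<open>An oracle call on \<open>s\<close> or \<open>t\<close>, which lie outside
  \<open>U\<close>, would block the machine. These symbols occupy heap positions but leave no trace
  in the query-sets.\<close>

definition unless_terminal :: "nat \<Rightarrow> nat \<Rightarrow> com \<Rightarrow> com" where
  "unless_terminal s t p =
     (Const rT s ;; If_Eq rX rT Skip (Const rT t ;; If_Eq rX rT Skip p))"

definition path_code :: com where
  "path_code = While_Less rZ rV
     (Load rI aQ rV ;; member_code rI ;; Store aQ rV rI ;; Load rV aPar rV)"

definition unlink_code :: "nat \<Rightarrow> nat \<Rightarrow> com" where
  "unlink_code s t =
     (Load rV aPos rX ;; Load rB 0 rX ;; unless_terminal s t path_code ;; Store aPos rX rZ)"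

text \<open>Subtraction from 1 negates the flag: at the nodes above its position an element of
  \<open>X\<close> has the opposite of its membership in \<open>S\<close>, which
  \<open>unlink_code\<close> restores.\<close>

definition link_code :: "nat \<Rightarrow> nat \<Rightarrow> com" where
  "link_code s t =
     (Copy rV rP ;; Load rB 0 rX ;; Sub rB rOne rB ;; unless_terminal s t path_code ;;
      Store aPos rX rP ;; Store aSlot rP rX)"

definition del_code :: "nat \<Rightarrow> nat \<Rightarrow> com" where
  "del_code s t =
     (consts_code ;; Copy rX 0 ;; Load rP aPos rX ;; unlink_code s t ;; Load rX aSlot rN ;;
      If_Less rP rN (unlink_code s t ;; link_code s t) Skip ;; Sub rN rN rOne)"

definition repl_code :: "nat \<Rightarrow> nat \<Rightarrow> com" where
  "repl_code s t =
     (consts_code ;; Copy rX 0 ;; Load rP aPos rX ;; unlink_code s t ;; Copy rX 1 ;; link_code s t)"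

text \<open>Ancestors have smaller positions, so one pass in increasing order walks only over nodes
  that have been reset to \<open>S\<close> already. Each position also records itself as parent of
  its two children, before these are reached. The root is reset ahead of the loop, hence also when
  \<open>X\<close> is empty.\<close>

definition rebuild_code :: "nat \<Rightarrow> nat \<Rightarrow> com" where
  "rebuild_code s t =
     (Const rD 0 ;; Store aPar rOne rZ ;; Store aQ rOne 2 ;; Const rP 0 ;;
      While_Less rP rN
        (Add rP rP rOne ;; Store aQ rP 2 ;;
         Add rT rP rP ;; Store aPar rT rP ;; Add rT rT rOne ;; Store aPar rT rP ;;
         Load rX aSlot rP ;; link_code s t))"

definition initialize_code :: "nat \<Rightarrow> nat \<Rightarrow> com" where
  "initialize_code s t =
     (consts_code ;; Copy 2 1 ;; Copy rN 0 ;; Const rP 0 ;;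
      While_Less rP rN (Load rX 1 rP ;; Add rP rP rOne ;; Store aSlot rP rX) ;;
      rebuild_code s t)"

text \<open>The root carries \<open>S\<close> toggled on \<open>X\<close>, so the flag is negated
  once more for an element with a positive heap position.\<close>

definition toggle_code :: com where
  "toggle_code =
     (Load rB 0 rX ;; Sub rB rOne rB ;; member_code 2 ;; Store 0 rX rB ;;
      Load rT aPos rX ;; If_Less rZ rT (Sub rB rOne rB) Skip ;;
      Load rI aQ rOne ;; member_code rI ;; Store aQ rOne rI ;;
      Store aD rD rX ;; Add rD rD rOne)"

definition upd_code :: "nat \<Rightarrow> nat \<Rightarrow> nat \<Rightarrow> com" where
  "upd_code \<beta> s t =
     (consts_code ;; Const rP 0 ;;
      While_Less rP 0 (Load rX 1 rP ;; Add rP rP rOne ;; unless_terminal s t toggle_code) ;;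
      Const rT \<beta> ;; If_Less rD rT Skip (rebuild_code s t))"

text \<open>The corrected query-set is held in a register only and not stored in the heap, so that
  \<open>Find\<close> changes no array and the log stays valid.\<close>

definition refresh_code :: com where
  "refresh_code =
     (Load rI aQ rC ;; Const rP 0 ;;
      While_Less rP rD
        (Load rX aD rP ;; Add rP rP rOne ;; Load rB 0 rX ;; Load rT aPos rX ;;
         While_Less rC rT (Load rT aPar rT) ;;
         If_Less rT rC Skip (Sub rB rOne rB) ;;
         member_code rI))"

definition probe_code :: "nat \<Rightarrow> com" where
  "probe_code s =
     (Const rT s ;;
      If_Eq rY rT
        (OQuery rL 2 ;; OQuery rR rI)
        (Load rT 0 rY ;;
         If_Less rZ rT
           (ODelete rL rY 2 ;; OQuery rL rL ;; ODelete rR rY rI ;; OQuery rR rR)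
           (OQuery rL rI ;; OInsert rR rY rI ;; OQuery rR rR)))"

definition try_code :: "nat \<Rightarrow> com" where
  "try_code s = If_Less rN rC Skip
     (refresh_code ;; probe_code s ;; If_Less rL rR (Copy rV rC ;; Const rG 1) Skip)"

definition descend_code :: "nat \<Rightarrow> com" where
  "descend_code s = While_Less rZ rG
     (Const rG 0 ;; Add rC rV rV ;; try_code s ;;
      If_Less rG rOne (Add rC rC rOne ;; try_code s) Skip)"

definition search_code :: "nat \<Rightarrow> com" where
  "search_code s =
     (consts_code ;; Copy rY 0 ;;
      If_Less rZ rN
        (Load rI aQ rOne ;; probe_code s ;;
         If_Less rL rR
           (Const rV 1 ;; Const rG 1 ;; descend_code s ;; Load 1 aSlot rV ;; Const 0 1)
           (Const 0 0))
        (Const 0 0))"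

definition exchange_structure :: "nat \<Rightarrow> nat \<Rightarrow> nat \<Rightarrow> data_structure" where
  "exchange_structure \<beta> s t =
     \<lparr>init_code = initialize_code s t, find_code = search_code s, delete_code = del_code s t,
      replace_code = repl_code s t, update_code = upd_code \<beta> s t\<rparr>"


section \<open>Invariants\<close>

text \<open>Query-sets are only ever appended, which is what keeps stored indices
  meaningful.\<close>

definition frame :: "nat set \<Rightarrow> nat set \<Rightarrow> ram \<Rightarrow> ram \<Rightarrow> bool" where
  "frame R A \<sigma> \<sigma>' \<longleftrightarrow>
     (\<forall>r. r \<notin> R \<longrightarrow> reg \<sigma>' r = reg \<sigma> r) \<and> (\<forall>a. a \<notin> A \<longrightarrow> arr \<sigma>' a = arr \<sigma> a) \<and>
     (\<exists>E. qsets \<sigma>' = qsets \<sigma> @ E)"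

lemma frame_trans:
  "frame R A \<sigma> \<sigma>' \<Longrightarrow> frame R' A' \<sigma>' \<sigma>'' \<Longrightarrow> R \<subseteq> R'' \<Longrightarrow> R' \<subseteq> R'' \<Longrightarrow> A \<subseteq> A'' \<Longrightarrow> A' \<subseteq> A'' \<Longrightarrow>
    frame R'' A'' \<sigma> \<sigma>''"
  unfolding frame_def by (metis append.assoc subsetD)

lemma frameD:
  assumes "frame R A \<sigma> \<sigma>'"
  shows "\<And>r. r \<notin> R \<Longrightarrow> reg \<sigma>' r = reg \<sigma> r"
    and "\<And>a. a \<notin> A \<Longrightarrow> arr \<sigma>' a = arr \<sigma> a"
    and "\<And>i. i < length (qsets \<sigma>) \<Longrightarrow> i < length (qsets \<sigma>') \<and> qsets \<sigma>' ! i = qsets \<sigma> ! i"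
  using assms by (auto simp: frame_def nth_append)

definition node :: "ram \<Rightarrow> nat \<Rightarrow> nat set" where
  "node \<sigma> v = qsets \<sigma> ! arr \<sigma> aQ v"

text \<open>With \<open>P\<close> mapping every element of \<open>X\<close> to its heap position and all others to 0, the elements
  \<open>u\<close> with \<open>v \<in> anc (P u)\<close> are those in the subtree of \<open>v\<close>.\<close>

definition target :: "nat \<Rightarrow> nat \<Rightarrow> nat set \<Rightarrow> (nat \<Rightarrow> nat) \<Rightarrow> nat \<Rightarrow> nat set" where
  "target s t S P v = {u. (u \<in> S) \<noteq> (u \<notin> {s, t} \<and> v \<in> anc (P u))}"

text \<open>The root is always exact; the other nodes may be wrong on the set \<open>D\<close> of logged elements.\<close>

definition tree_ok ::
  "nat \<Rightarrow> nat \<Rightarrow> nat set \<Rightarrow> (nat \<Rightarrow> nat) \<Rightarrow> nat \<Rightarrow> nat set \<Rightarrow> ram \<Rightarrow> bool" where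
  "tree_ok s t S P N D \<sigma> \<longleftrightarrow>
     (\<forall>v. arr \<sigma> aQ v < length (qsets \<sigma>)) \<and>
     (\<forall>v\<in>{1..max 1 N}. \<forall>u. (u \<in> D \<longrightarrow> v = 1) \<longrightarrow> (u \<in> node \<sigma> v \<longleftrightarrow> u \<in> target s t S P v))"

text \<open>Position 0 stands for absence from \<open>X\<close>: it is tested by the programs, and
  \<open>anc 0\<close> is empty, so absent elements lie below no node.\<close>

definition indexed :: "nat set \<Rightarrow> nat \<Rightarrow> (nat \<Rightarrow> nat) \<Rightarrow> (nat \<Rightarrow> nat) \<Rightarrow> bool" where
  "indexed X N P Q \<longleftrightarrow>
     (\<forall>u\<in>X. P u \<in> {1..N} \<and> Q (P u) = u) \<and> (\<forall>u. u \<notin> X \<longrightarrow> P u = 0) \<and>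
     (\<forall>j\<in>{1..N}. Q j \<in> X \<and> P (Q j) = j)"

definition dirty :: "ram \<Rightarrow> nat set" where
  "dirty \<sigma> = arr \<sigma> aD ` {..<reg \<sigma> rD}"

definition ds_inv :: "nat set \<Rightarrow> nat \<Rightarrow> nat \<Rightarrow> nat set \<Rightarrow> nat set \<Rightarrow> ram \<Rightarrow> bool" where
  "ds_inv U s t S X \<sigma> \<longleftrightarrow>
     S \<subseteq> U \<and> X \<subseteq> U \<union> {s, t} \<and> maintains S \<sigma> \<and>
     indexed X (reg \<sigma> rN) (arr \<sigma> aPos) (arr \<sigma> aSlot) \<and>
     (\<forall>j\<in>{1..reg \<sigma> rN}. arr \<sigma> aPar j = j div 2) \<and> dirty \<sigma> \<subseteq> U \<and>
     tree_ok s t S (arr \<sigma> aPos) (reg \<sigma> rN) (dirty \<sigma>) \<sigma>"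


lemma indexed_slots:
  assumes "indexed X N P Q"
  shows "X = Q ` {1..N}" "inj_on Q {1..N}"
proof -
  show "X = Q ` {1..N}"
    using assms by (fastforce simp: indexed_def image_iff Bex_def)
  show "inj_on Q {1..N}"
    using assms by (intro inj_on_inverseI[where g = P]) (simp add: indexed_def)
qed

lemma indexed_card:
  assumes "indexed X N P Q"
  shows "finite X" "card X = N"
  using indexed_slots[OF assms] card_image[OF indexed_slots(2)[OF assms]] by simp_all

text \<open>If \<open>x\<close> is itself the last element, moving the last element into the hole
  would put \<open>x\<close> back; this case has to be separated from
  \<open>indexed_delete\<close>.\<close>

lemma indexed_delete_last:
  assumes "indexed X N P Q" "x \<in> X" "P x = N"
  shows "indexed (X - {x}) (N - 1) (P(x := 0)) Q"
proof -
  have in_X: "P u \<in> {1..N} \<and> Q (P u) = u" if "u \<in> X" for u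
    using assms(1) that by (simp add: indexed_def)
  have out_X: "P u = 0" if "u \<notin> X" for u
    using assms(1) that by (simp add: indexed_def)
  have slot: "Q j \<in> X \<and> P (Q j) = j" if "j \<in> {1..N}" for j
    using assms(1) that by (simp add: indexed_def)
  show ?thesis
    unfolding indexed_def
  proof (intro conjI ballI allI impI)
    fix u assume u: "u \<in> X - {x}"
    then have "P u \<noteq> N" using in_X[of u] in_X[of x] assms(2,3) by (metis DiffD1 DiffD2 singletonI)
    moreover have "1 \<le> P u" "P u \<le> N" "Q (P u) = u" using in_X[of u] u by auto
    ultimately show "(P(x := 0)) u \<in> {1..N - 1}" "Q ((P(x := 0)) u) = u" using u by auto
  next
    fix u assume "u \<notin> X - {x}"
    then show "(P(x := 0)) u = 0" using out_X[of u] by auto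
  next
    fix j assume "j \<in> {1..N - 1}"
    then have "j \<in> {1..N}" "j \<noteq> N" by auto
    then have "Q j \<in> X" "P (Q j) = j" "Q j \<noteq> x" using slot[of j] assms(3) by (simp, simp, metis)
    then show "Q j \<in> X - {x}" "(P(x := 0)) (Q j) = j" by auto
  qed
qed

lemma indexed_delete:
  assumes "indexed X N P Q" "x \<in> X" "P x < N"
  shows "indexed (X - {x}) (N - 1) (P(x := 0, Q N := P x)) (Q(P x := Q N))"
proof -
  have in_X: "P u \<in> {1..N} \<and> Q (P u) = u" if "u \<in> X" for u
    using assms(1) that by (simp add: indexed_def)
  have out_X: "P u = 0" if "u \<notin> X" for u
    using assms(1) that by (simp add: indexed_def)
  have slot: "Q j \<in> X \<and> P (Q j) = j" if "j \<in> {1..N}" for j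
    using assms(1) that by (simp add: indexed_def)
  have px: "P x \<in> {1..N - 1}" using in_X[OF assms(2)] assms(3) by auto
  then have z: "Q N \<in> X" "P (Q N) = N" using slot[of N] by auto
  have ne: "Q N \<noteq> x" using z(2) assms(3) by (metis less_irrefl)
  show ?thesis
    unfolding indexed_def
  proof (intro conjI ballI allI impI)
    fix u assume u: "u \<in> X - {x}"
    have "P u \<noteq> P x" using in_X[of u] in_X[of x] u assms(2) by (metis DiffD1 DiffD2 singletonI)
    moreover have "P u \<in> {1..N - 1}" if "u \<noteq> Q N"
    proof -
      have "P u \<noteq> N" using in_X[of u] u that by (metis DiffD1)
      moreover have "1 \<le> P u" "P u \<le> N" using in_X[of u] u by auto
      ultimately show ?thesis by simp
    qed
    ultimately show "(P(x := 0, Q N := P x)) u \<in> {1..N - 1}"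
      and "(Q(P x := Q N)) ((P(x := 0, Q N := P x)) u) = u"
      using px u in_X[of u] by (cases "u = Q N"; simp)+
  next
    fix u assume "u \<notin> X - {x}"
    then show "(P(x := 0, Q N := P x)) u = 0"
      using out_X[of u] z(1) ne by (cases "u = x") auto
  next
    fix j assume j: "j \<in> {1..N - 1}"
    then have "j \<in> {1..N}" "j \<noteq> N" by auto
    then have Qj: "Q j \<in> X" "P (Q j) = j" "Q j \<noteq> Q N" using slot[of j] z(2) by (simp, simp, metis)
    moreover have "Q j \<noteq> x" if "j \<noteq> P x" using Qj(2) that by metis
    ultimately show "(Q(P x := Q N)) j \<in> X - {x}"
      "(P(x := 0, Q N := P x)) ((Q(P x := Q N)) j) = j"
      using z(1) ne by (cases "j = P x"; simp)+
  qed
qed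

lemma indexed_replace:
  assumes "indexed X N P Q" "x \<in> X" "y \<notin> X"
  shows "indexed (X - {x} \<union> {y}) N (P(x := 0, y := P x)) (Q(P x := y))"
proof -
  have "P x \<in> {1..N}" "Q (P x) = x" "x \<noteq> y"
    using assms by (auto simp: indexed_def)
  moreover have "P u \<noteq> P x" if "u \<in> X" "u \<noteq> x" for u
    using assms(1,2) that unfolding indexed_def by (metis (full_types))
  ultimately show ?thesis using assms unfolding indexed_def by auto
qed

section \<open>Heap operations\<close>

lemma node_update_simps [simp]:
  "node (\<sigma>\<lparr>reg := f\<rparr>) = node \<sigma>"
  "g aQ = arr \<sigma> aQ \<Longrightarrow> node (\<sigma>\<lparr>arr := g\<rparr>) = node \<sigma>"
  by (auto simp: node_def)

lemma tree_ok_update_simps [simp]: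
  "tree_ok s t S P N D (\<sigma>\<lparr>reg := f\<rparr>) = tree_ok s t S P N D \<sigma>"
  "g aQ = arr \<sigma> aQ \<Longrightarrow> tree_ok s t S P N D (\<sigma>\<lparr>arr := g\<rparr>) = tree_ok s t S P N D \<sigma>"
  by (auto simp: tree_ok_def)

lemma tree_ok_le: "tree_ok s t S P N D \<sigma> \<Longrightarrow> N' \<le> N \<Longrightarrow> tree_ok s t S P N' D \<sigma>"
  unfolding tree_ok_def by auto

lemma maintains_frame:
  "maintains S \<sigma> \<Longrightarrow> frame R A \<sigma> \<sigma>' \<Longrightarrow> 2 \<notin> R \<Longrightarrow> 0 \<notin> A \<Longrightarrow> maintains S \<sigma>'"
  unfolding maintains_def by (simp add: frameD)

lemma dirty_frame: "frame R A \<sigma> \<sigma>' \<Longrightarrow> rD \<notin> R \<Longrightarrow> aD \<notin> A \<Longrightarrow> dirty \<sigma>' = dirty \<sigma>"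
  unfolding dirty_def by (simp add: frameD)

lemma dirty_update_simps [simp]:
  "f rD = reg \<sigma> rD \<Longrightarrow> dirty (\<sigma>\<lparr>reg := f\<rparr>) = dirty \<sigma>"
  "g aD = arr \<sigma> aD \<Longrightarrow> dirty (\<sigma>\<lparr>arr := g\<rparr>) = dirty \<sigma>"
  by (auto simp: dirty_def)

lemma wp_path_code:
  assumes "reg \<sigma> rZ = 0" "reg \<sigma> rX = x" "reg \<sigma> rV = p" "reg \<sigma> rB = of_bool b" "x \<in> U"
    and "\<forall>v. arr \<sigma> aQ v < length (qsets \<sigma>)" "\<forall>j\<in>{1..p}. arr \<sigma> aPar j = j div 2"
  shows "wp U I path_code \<sigma> (\<lambda>m \<sigma>'. m \<le> Suc (6 * bits p) \<and>
    frame {rV, rI} {aQ} \<sigma> \<sigma>' \<and> (\<forall>v. arr \<sigma>' aQ v < length (qsets \<sigma>')) \<and>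
    (\<forall>v u. u \<in> node \<sigma>' v \<longleftrightarrow> (if u = x \<and> v \<in> anc p then b else u \<in> node \<sigma> v)))"
  using assms
proof (induction p arbitrary: \<sigma> rule: less_induct)
  case (less p)
  show ?case
  proof (cases "p = 0")
    case True
    then show ?thesis
      using less.prems unfolding path_code_def
      by (subst wp_While_iff) (auto simp: frame_def)
  next
    case False
    then have p: "0 < p" "arr \<sigma> aPar p = p div 2"
      using less.prems by auto
    define A where "A = (if b then node \<sigma> p \<union> {x} else node \<sigma> p - {x})"
    define \<tau> where "\<tau> = add_qset A \<sigma>
        \<lparr>arr := (arr \<sigma>)(aQ := (arr \<sigma> aQ)(p := length (qsets \<sigma>))),
         reg := (reg \<sigma>)(rI := length (qsets \<sigma>), rV := p div 2)\<rparr>"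
    have bound: "\<forall>v. arr \<tau> aQ v < length (qsets \<tau>)"
      using less.prems(6) by (auto simp: \<tau>_def less_Suc_eq)
    have nodes: "node \<tau> v = (if v = p then A else node \<sigma> v)" for v
      using less.prems(6) by (auto simp: \<tau>_def node_def nth_append)
    have fr: "frame {rV, rI} {aQ} \<sigma> \<tau>"
      by (auto simp: frame_def \<tau>_def)
    have IH: "wp U I path_code \<tau> (\<lambda>m \<sigma>'. m \<le> Suc (6 * bits (p div 2)) \<and>
      frame {rV, rI} {aQ} \<tau> \<sigma>' \<and> (\<forall>v. arr \<sigma>' aQ v < length (qsets \<sigma>')) \<and>
      (\<forall>v u. u \<in> node \<sigma>' v \<longleftrightarrow> (if u = x \<and> v \<in> anc (p div 2) then b else u \<in> node \<tau> v)))"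
      using less.prems bound p(1) by (intro less.IH) (auto simp: \<tau>_def)
    \<comment> \<open>The rest of the walk stays strictly above \<open>p\<close>, so the set just
      stored there is final.\<close>
    have "p \<notin> anc (p div 2)" using anc_bounds[of p "p div 2"] p(1) by auto
    then have anc_node: "(if u = x \<and> v \<in> anc (p div 2) then b else u \<in> node \<tau> v) =
      (if u = x \<and> v \<in> anc p then b else u \<in> node \<sigma> v)" for v u
      using p(1) by (auto simp: nodes anc_pos A_def)
    \<comment> \<open>Six steps per level: loop test, two loads, branch, oracle call and
      store.\<close>
    have "wp U I path_code \<tau> (\<lambda>m \<sigma>'. m + 6 \<le> Suc (6 * bits p) \<and>
      frame {rV, rI} {aQ} \<sigma> \<sigma>' \<and> (\<forall>v. arr \<sigma>' aQ v < length (qsets \<sigma>')) \<and>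
      (\<forall>v u. u \<in> node \<sigma>' v \<longleftrightarrow> (if u = x \<and> v \<in> anc p then b else u \<in> node \<sigma> v)))"
      using p(1) unfolding anc_node[symmetric]
      by (intro wp_mono[OF IH]) (auto simp: bits_pos intro: frame_trans[OF fr])
    then show ?thesis
      using less.prems p unfolding path_code_def \<tau>_def
      by (subst wp_While_iff, cases b)
        (simp add: member_code_def A_def node_def; erule wp_mono; simp)+
  qed
qed

lemma wp_guarded_path_code:
  assumes "reg \<sigma> rZ = 0" "reg \<sigma> rX = x" "reg \<sigma> rV = p" "reg \<sigma> rB = of_bool b" "x \<in> U \<union> {s, t}"
    and "\<forall>v. arr \<sigma> aQ v < length (qsets \<sigma>)" "\<forall>j\<in>{1..p}. arr \<sigma> aPar j = j div 2"
  shows "wp U I (unless_terminal s t path_code) \<sigma> (\<lambda>m \<sigma>'. m \<le> 6 * bits p + 7 \<and>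
    frame {rV, rI, rT} {aQ} \<sigma> \<sigma>' \<and> (\<forall>v. arr \<sigma>' aQ v < length (qsets \<sigma>')) \<and>
    (\<forall>v u. u \<in> node \<sigma>' v \<longleftrightarrow>
       (if u = x \<and> u \<notin> {s, t} \<and> v \<in> anc p then b else u \<in> node \<sigma> v)))"
    (is "wp U I _ \<sigma> ?Q")
proof (cases "x \<in> {s, t}")
  case True
  then show ?thesis
    using assms by (auto simp: unless_terminal_def frame_def)
next
  case False
  let ?\<tau> = "set_reg rT t \<sigma>"
  have fr: "frame {rT} {} \<sigma> ?\<tau>" by (simp add: frame_def)
  have "wp U I path_code ?\<tau> (\<lambda>m \<sigma>'. m \<le> Suc (6 * bits p) \<and>
    frame {rV, rI} {aQ} ?\<tau> \<sigma>' \<and> (\<forall>v. arr \<sigma>' aQ v < length (qsets \<sigma>')) \<and>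
    (\<forall>v u. u \<in> node \<sigma>' v \<longleftrightarrow> (if u = x \<and> v \<in> anc p then b else u \<in> node ?\<tau> v)))"
    using assms False by (intro wp_path_code) auto
  \<comment> \<open>The guard costs at most six steps: two constants, each followed by at most two
    comparisons.\<close>
  then have "wp U I path_code ?\<tau> (\<lambda>m \<sigma>'. ?Q (m + 6) \<sigma>')"
    by (rule wp_mono) (use False in \<open>auto intro: frame_trans[OF fr]\<close>)
  then show ?thesis
    using False assms(2) unfolding unless_terminal_def
    by (auto simp: neq_iff intro: wp_mono)
qed

lemma wp_unlink_code:
  assumes "reg \<sigma> rZ = 0" "reg \<sigma> rX = x" "arr \<sigma> aPos x = p" "x \<in> U \<union> {s, t}"
    and "\<forall>v. arr \<sigma> 0 v = of_bool (v \<in> S)" "\<forall>j\<in>{1..p}. arr \<sigma> aPar j = j div 2"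
    and "tree_ok s t S P N D \<sigma>" "P x = p"
  shows "wp U I (unlink_code s t) \<sigma> (\<lambda>m \<sigma>'. m \<le> 6 * bits p + 10 \<and>
    frame {rV, rI, rT, rB} {aQ, aPos} \<sigma> \<sigma>' \<and> arr \<sigma>' aPos = (arr \<sigma> aPos)(x := 0) \<and>
    tree_ok s t S (P(x := 0)) N D \<sigma>')"
proof -
  let ?\<tau> = "\<sigma>\<lparr>reg := (reg \<sigma>)(rV := p, rB := of_bool (x \<in> S))\<rparr>"
  have fr: "frame {rV, rB} {} \<sigma> ?\<tau>" by (simp add: frame_def)
  have "wp U I (unless_terminal s t path_code) ?\<tau> (\<lambda>m \<sigma>'. m \<le> 6 * bits p + 7 \<and>
    frame {rV, rI, rT} {aQ} ?\<tau> \<sigma>' \<and> (\<forall>v. arr \<sigma>' aQ v < length (qsets \<sigma>')) \<and>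
    (\<forall>v u. u \<in> node \<sigma>' v \<longleftrightarrow>
       (if u = x \<and> u \<notin> {s, t} \<and> v \<in> anc p then x \<in> S else u \<in> node ?\<tau> v)))"
    using assms by (intro wp_guarded_path_code) (auto simp: tree_ok_def)
  then show ?thesis
    unfolding unlink_code_def using assms(2,3,5)
  proof (simp split del: split_of_bool, elim wp_mono, goal_cases)
    case (1 m \<sigma>')
    then have fr': "frame {rV, rI, rT} {aQ} ?\<tau> \<sigma>'" by blast
    have "frame {rV, rI, rT, rB} {aQ, aPos} \<sigma> (set_arr aPos x 0 \<sigma>')"
      using frame_trans[OF fr fr', of "{rV, rI, rT, rB}" "{aQ, aPos}"]
      by (auto simp: frame_def)
    moreover have "tree_ok s t S (P(x := 0)) N D \<sigma>'"
      using 1 assms(7,8) by (simp add: tree_ok_def target_def)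
    ultimately show ?case using 1 frameD[OF fr'] assms(1,2) by simp
  qed
qed

text \<open>The map \<open>P\<close> is a parameter of its own, distinct from the array
  \<open>aPos\<close>, because during a rebuilding the array may still hold old positions of
  elements that have not been placed again.\<close>

lemma wp_link_code:
  assumes "reg \<sigma> rZ = 0" "reg \<sigma> rOne = 1" "reg \<sigma> rX = x" "reg \<sigma> rP = p" "x \<in> U \<union> {s, t}"
    and "\<forall>v. arr \<sigma> 0 v = of_bool (v \<in> S)" "\<forall>j\<in>{1..p}. arr \<sigma> aPar j = j div 2"
    and "tree_ok s t S P N D \<sigma>" "P x = 0"
  shows "wp U I (link_code s t) \<sigma> (\<lambda>m \<sigma>'. m \<le> 6 * bits p + 12 \<and>
    frame {rV, rI, rT, rB} {aQ, aPos, aSlot} \<sigma> \<sigma>' \<and>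
    arr \<sigma>' aPos = (arr \<sigma> aPos)(x := p) \<and> arr \<sigma>' aSlot = (arr \<sigma> aSlot)(p := x) \<and>
    tree_ok s t S (P(x := p)) N D \<sigma>')"
proof -
  let ?\<tau> = "\<sigma>\<lparr>reg := (reg \<sigma>)(rV := p, rB := of_bool (x \<notin> S))\<rparr>"
  have fr: "frame {rV, rB} {} \<sigma> ?\<tau>" by (simp add: frame_def)
  have "wp U I (unless_terminal s t path_code) ?\<tau> (\<lambda>m \<sigma>'. m \<le> 6 * bits p + 7 \<and>
    frame {rV, rI, rT} {aQ} ?\<tau> \<sigma>' \<and> (\<forall>v. arr \<sigma>' aQ v < length (qsets \<sigma>')) \<and>
    (\<forall>v u. u \<in> node \<sigma>' v \<longleftrightarrow>
       (if u = x \<and> u \<notin> {s, t} \<and> v \<in> anc p then x \<notin> S else u \<in> node ?\<tau> v)))"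
    using assms by (intro wp_guarded_path_code) (auto simp: tree_ok_def)
  moreover have "Suc 0 - of_bool (x \<in> S) = of_bool (x \<notin> S)" by simp
  ultimately show ?thesis
    unfolding link_code_def using assms(2,3,4,6)
  proof (simp del: of_bool_not_iff split del: split_of_bool, elim wp_mono, goal_cases)
    case (1 m \<sigma>')
    then have fr': "frame {rV, rI, rT} {aQ} ?\<tau> \<sigma>'" by blast
    have "frame {rV, rI, rT, rB} {aQ, aPos, aSlot} \<sigma> (set_arr aSlot p x (set_arr aPos x p \<sigma>'))"
      using frame_trans[OF fr fr', of "{rV, rI, rT, rB}" "{aQ, aPos, aSlot}"]
      by (auto simp: frame_def)
    moreover have "tree_ok s t S (P(x := p)) N D \<sigma>'"
      using 1 assms(8,9) by (simp add: tree_ok_def target_def)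
    ultimately show ?case using 1 frameD[OF fr'] assms(3,4) by simp
  qed
qed

section \<open>Replacing and deleting elements of \<open>X\<close>\<close>

lemma wp_repl_code:
  assumes inv: "ds_inv U s t S X \<sigma>" and xy: "reg \<sigma> 0 = x" "reg \<sigma> 1 = y" "x \<in> X" "y \<notin> X"
    and y: "y \<in> U \<union> {s, t}"
  shows "wp U I (repl_code s t) \<sigma> (\<lambda>m \<sigma>'. m \<le> 12 * bits (reg \<sigma> rN) + 40 \<and>
    ds_inv U s t S (X - {x} \<union> {y}) \<sigma>' \<and> reg \<sigma>' rN = reg \<sigma> rN \<and> reg \<sigma>' rD = reg \<sigma> rD)"
proof -
  let ?P = "arr \<sigma> aPos" let ?N = "reg \<sigma> rN" let ?p = "?P x"
  let ?\<sigma>\<^sub>1 = "\<sigma>\<lparr>reg := (reg \<sigma>)(rZ := 0, rOne := 1, rX := x, rP := ?p)\<rparr>"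
  have idx: "indexed X ?N ?P (arr \<sigma> aSlot)" and m: "maintains S \<sigma>"
    and par: "\<forall>j\<in>{1..?N}. arr \<sigma> aPar j = j div 2"
    and tree: "tree_ok s t S ?P ?N (dirty \<sigma>) \<sigma>"
    using inv by (auto simp: ds_inv_def)
  have p: "?p \<in> {1..?N}" and Py: "?P y = 0" using idx xy by (auto simp: indexed_def)
  have bits: "bits ?p \<le> bits ?N" using p by (intro bits_mono) simp
  have fr1: "frame {rZ, rOne, rX, rP} {} \<sigma> ?\<sigma>\<^sub>1" by (simp add: frame_def)
  have "wp U I (unlink_code s t) ?\<sigma>\<^sub>1 (\<lambda>m \<sigma>'. m \<le> 6 * bits ?p + 10 \<and>
    frame {rV, rI, rT, rB} {aQ, aPos} ?\<sigma>\<^sub>1 \<sigma>' \<and> arr \<sigma>' aPos = (arr ?\<sigma>\<^sub>1 aPos)(x := 0) \<and>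
    tree_ok s t S (?P(x := 0)) ?N (dirty \<sigma>) \<sigma>')"
    by (rule wp_unlink_code) (use inv xy p par m tree in \<open>auto simp: ds_inv_def maintains_def\<close>)
  then show ?thesis
    unfolding repl_code_def consts_code_def using xy(1)
  proof (simp, elim wp_mono, goal_cases)
    case (1 m2 \<sigma>\<^sub>2)
    then have fr2: "frame {rV, rI, rT, rB} {aQ, aPos} ?\<sigma>\<^sub>1 \<sigma>\<^sub>2"
      and m2: "m2 \<le> 6 * bits ?p + 10"
      and pos2: "arr \<sigma>\<^sub>2 aPos = ?P(x := 0)"
      and tree2: "tree_ok s t S (?P(x := 0)) ?N (dirty \<sigma>) \<sigma>\<^sub>2"
      by simp_all
    note fr2' = frameD[OF fr2, simplified]
    have "wp U I (link_code s t) (set_reg rX y \<sigma>\<^sub>2) (\<lambda>m \<sigma>'. m \<le> 6 * bits ?p + 12 \<and>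
      frame {rV, rI, rT, rB} {aQ, aPos, aSlot} (set_reg rX y \<sigma>\<^sub>2) \<sigma>' \<and>
      arr \<sigma>' aPos = (arr (set_reg rX y \<sigma>\<^sub>2) aPos)(y := ?p) \<and>
      arr \<sigma>' aSlot = (arr (set_reg rX y \<sigma>\<^sub>2) aSlot)(?p := y) \<and>
      tree_ok s t S (?P(x := 0, y := ?p)) ?N (dirty \<sigma>) \<sigma>')"
      by (rule wp_link_code)
        (use y fr2' p par Py tree2 m in \<open>auto simp: maintains_def\<close>)
    moreover have "reg \<sigma>\<^sub>2 1 = y" using fr2' xy by simp
    ultimately show ?case
    proof (simp, elim wp_mono, goal_cases)
      case (1 m3 \<sigma>\<^sub>3)
      then have fr3: "frame {rV, rI, rT, rB} {aQ, aPos, aSlot} (set_reg rX y \<sigma>\<^sub>2) \<sigma>\<^sub>3" by simp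
      have fr3': "frame {rX} {} \<sigma>\<^sub>2 (set_reg rX y \<sigma>\<^sub>2)" by (simp add: frame_def)
      let ?R = "{rV, rI, rT, rB, rZ, rOne, rX, rP}" let ?A = "{aQ, aPos, aSlot}"
      have "frame ?R ?A \<sigma> \<sigma>\<^sub>2" by (rule frame_trans[OF fr1 fr2]) auto
      then have "frame ?R ?A \<sigma> (set_reg rX y \<sigma>\<^sub>2)" by (rule frame_trans[OF _ fr3']) auto
      then have fr: "frame ?R ?A \<sigma> \<sigma>\<^sub>3" by (rule frame_trans[OF _ fr3]) auto
      note frD = frameD[OF fr, simplified]
      have "ds_inv U s t S (X - {x} \<union> {y}) \<sigma>\<^sub>3"
        unfolding ds_inv_def
        using 1 inv y indexed_replace[OF idx xy(3,4)] maintains_frame[OF m fr] dirty_frame[OF fr]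
        by (auto simp: frD fr2' pos2 ds_inv_def)
      then show ?case using 1 m2 bits by (simp add: frD)
    qed
  qed
qed

lemma wp_del_code:
  assumes inv: "ds_inv U s t S X \<sigma>" and x: "reg \<sigma> 0 = x" "x \<in> X"
  shows "wp U I (del_code s t) \<sigma> (\<lambda>m \<sigma>'. m \<le> 18 * bits (reg \<sigma> rN) + 50 \<and>
    ds_inv U s t S (X - {x}) \<sigma>' \<and> reg \<sigma>' rN = reg \<sigma> rN - 1 \<and> reg \<sigma>' rD = reg \<sigma> rD)"
proof -
  let ?P = "arr \<sigma> aPos" let ?N = "reg \<sigma> rN" let ?p = "?P x" let ?z = "arr \<sigma> aSlot (reg \<sigma> rN)"
  let ?\<sigma>\<^sub>1 = "\<sigma>\<lparr>reg := (reg \<sigma>)(rZ := 0, rOne := 1, rX := x, rP := ?p)\<rparr>"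
  have idx: "indexed X ?N ?P (arr \<sigma> aSlot)" and m: "maintains S \<sigma>"
    and par: "\<forall>j\<in>{1..?N}. arr \<sigma> aPar j = j div 2"
    and tree: "tree_ok s t S ?P ?N (dirty \<sigma>) \<sigma>" and XU: "X \<subseteq> U \<union> {s, t}"
    using inv by (auto simp: ds_inv_def)
  have p: "?p \<in> {1..?N}" using idx x by (auto simp: indexed_def)
  then have z: "?z \<in> X" "?P ?z = ?N" using idx by (auto simp: indexed_def)
  have bits: "bits ?p \<le> bits ?N" using p by (intro bits_mono) simp
  have fr1: "frame {rZ, rOne, rX, rP} {} \<sigma> ?\<sigma>\<^sub>1" by (simp add: frame_def)
  let ?R = "{rV, rI, rT, rB, rZ, rOne, rX, rP, rN}" let ?A = "{aQ, aPos, aSlot}"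
  have "wp U I (unlink_code s t) ?\<sigma>\<^sub>1 (\<lambda>m \<sigma>'. m \<le> 6 * bits ?p + 10 \<and>
    frame {rV, rI, rT, rB} {aQ, aPos} ?\<sigma>\<^sub>1 \<sigma>' \<and> arr \<sigma>' aPos = (arr ?\<sigma>\<^sub>1 aPos)(x := 0) \<and>
    tree_ok s t S (?P(x := 0)) ?N (dirty \<sigma>) \<sigma>')"
    by (rule wp_unlink_code) (use inv x p par m tree in \<open>auto simp: ds_inv_def maintains_def\<close>)
  then show ?thesis
    unfolding del_code_def consts_code_def using x(1)
  proof (simp, elim wp_mono, goal_cases)
    case (1 m2 \<sigma>\<^sub>2)
    then have fr2: "frame {rV, rI, rT, rB} {aQ, aPos} ?\<sigma>\<^sub>1 \<sigma>\<^sub>2"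
      and m2: "m2 \<le> 6 * bits ?p + 10"
      and pos2: "arr \<sigma>\<^sub>2 aPos = ?P(x := 0)"
      and tree2: "tree_ok s t S (?P(x := 0)) ?N (dirty \<sigma>) \<sigma>\<^sub>2"
      by simp_all
    note fr2' = frameD[OF fr2, simplified]
    have fr: "frame ?R ?A \<sigma> \<sigma>\<^sub>2" by (rule frame_trans[OF fr1 fr2]) auto
    let ?\<tau> = "set_reg rX ?z \<sigma>\<^sub>2"
    have fr': "frame ?R ?A \<sigma> ?\<tau>" using fr by (simp add: frame_def)
    show ?case
    proof (cases "?p < ?N")
      case False
      \<comment> \<open>Nothing is moved here; the stale entry in the last slot falls outside the
        shortened heap.\<close>
      then have pN: "?p = ?N" using p by simp
      let ?\<rho> = "\<sigma>\<^sub>2\<lparr>reg := (reg \<sigma>\<^sub>2)(rX := ?z, rN := ?N - 1)\<rparr>"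
      have fr3: "frame ?R ?A \<sigma> ?\<rho>" using fr by (simp add: frame_def)
      have "ds_inv U s t S (X - {x}) ?\<rho>"
        unfolding ds_inv_def
        using inv indexed_delete_last[OF idx x(2) pN] maintains_frame[OF m fr3]
          dirty_frame[OF fr3] tree_ok_le[OF tree2, of "?N - 1"]
        by (auto simp: frameD[OF fr3] ds_inv_def pos2 fr2')
      then show ?thesis using False m2 bits by (simp add: fr2')
    next
      case True
      then have zx: "?z \<noteq> x" using z by auto
      have "wp U I (unlink_code s t) ?\<tau> (\<lambda>m \<sigma>'. m \<le> 6 * bits ?N + 10 \<and>
        frame {rV, rI, rT, rB} {aQ, aPos} ?\<tau> \<sigma>' \<and> arr \<sigma>' aPos = (arr ?\<tau> aPos)(?z := 0) \<and>
        tree_ok s t S (?P(x := 0, ?z := 0)) ?N (dirty \<sigma>) \<sigma>')"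
        by (rule wp_unlink_code)
          (use fr2' z zx XU par m tree2 in \<open>auto simp: pos2 maintains_def\<close>)
      with True show ?thesis
      proof (simp add: fr2', elim wp_mono, goal_cases)
        case (1 m3 \<sigma>\<^sub>3)
        then have fr3: "frame {rV, rI, rT, rB} {aQ, aPos} ?\<tau> \<sigma>\<^sub>3"
          and m3: "m3 \<le> 6 * bits ?N + 10"
          and pos3: "arr \<sigma>\<^sub>3 aPos = ?P(x := 0, ?z := 0)"
          and tree3: "tree_ok s t S (?P(x := 0, ?z := 0)) ?N (dirty \<sigma>) \<sigma>\<^sub>3"
          by (simp_all add: pos2)
        note fr3' = frameD[OF fr3, simplified]
        have frt: "frame ?R ?A \<sigma> \<sigma>\<^sub>3" by (rule frame_trans[OF fr' fr3]) auto
        have "wp U I (link_code s t) \<sigma>\<^sub>3 (\<lambda>m \<sigma>'. m \<le> 6 * bits ?p + 12 \<and>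
          frame {rV, rI, rT, rB} {aQ, aPos, aSlot} \<sigma>\<^sub>3 \<sigma>' \<and>
          arr \<sigma>' aPos = (arr \<sigma>\<^sub>3 aPos)(?z := ?p) \<and> arr \<sigma>' aSlot = (arr \<sigma>\<^sub>3 aSlot)(?p := ?z) \<and>
          tree_ok s t S (?P(x := 0, ?z := 0, ?z := ?p)) ?N (dirty \<sigma>) \<sigma>')"
          by (rule wp_link_code)
            (use fr2' fr3' z XU p par tree3 m in \<open>auto simp: maintains_def\<close>)
        then show ?case
        proof (elim wp_mono, goal_cases)
          case (1 m4 \<sigma>\<^sub>4)
          then have fr4: "frame {rV, rI, rT, rB} ?A \<sigma>\<^sub>3 \<sigma>\<^sub>4" by simp
          have fr: "frame ?R ?A \<sigma> \<sigma>\<^sub>4" by (rule frame_trans[OF frt fr4]) auto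
          let ?\<rho> = "set_reg rN (?N - 1) \<sigma>\<^sub>4"
          have fr5: "frame ?R ?A \<sigma> ?\<rho>" using fr by (simp add: frame_def)
          have N1: "reg \<sigma>\<^sub>4 rN = ?N" "reg \<sigma>\<^sub>4 rOne = 1" "reg \<sigma>\<^sub>4 rD = reg \<sigma> rD"
            using frameD[OF fr4] by (simp_all add: fr2' fr3')
          have "ds_inv U s t S (X - {x}) ?\<rho>"
            unfolding ds_inv_def
            using inv indexed_delete[OF idx x(2) True] maintains_frame[OF m fr5]
              dirty_frame[OF fr5] tree_ok_le[of s t S _ ?N _ \<sigma>\<^sub>4 "?N - 1"] 1
            by (auto simp: frameD[OF fr] ds_inv_def pos3 fr2' fr3')
          then show ?case using 1 m2 m3 bits by (simp add: N1)
        qed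
      qed
    qed
  qed
qed

section \<open>Rebuilding, initialization and updates\<close>

text \<open>Nodes and parents are computed afresh from an injective enumeration of \<open>X\<close>
  by the slots. The same specification thus covers \<open>Initialize\<close>, where no heap exists
  yet, and \<open>Update\<close>, where the old one is outdated.\<close>

lemma wp_rebuild_code:
  assumes c: "reg \<sigma> rZ = 0" "reg \<sigma> rOne = 1" and m: "maintains S \<sigma>"
    and sub: "S \<subseteq> U" "X \<subseteq> U \<union> {s, t}"
    and N: "reg \<sigma> rN = N" and slots: "inj_on (arr \<sigma> aSlot) {1..N}" "X = arr \<sigma> aSlot ` {1..N}"
    and pos: "\<forall>u. u \<notin> X \<longrightarrow> arr \<sigma> aPos u = 0" and q: "\<forall>v. arr \<sigma> aQ v < length (qsets \<sigma>)"
  shows "wp U I (rebuild_code s t) \<sigma> (\<lambda>m \<sigma>'. m \<le> N * (6 * bits N + 20) + 5 \<and>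
    ds_inv U s t S X \<sigma>' \<and> reg \<sigma>' rN = N \<and> reg \<sigma>' rD = 0)"
proof -
  let ?Q = "arr \<sigma> aSlot"
  let ?R = "{rD, rP, rT, rX, rV, rI, rB}" let ?A = "{aPar, aQ, aPos, aSlot}"
  \<comment> \<open>The position map of the partial heap: elements beyond the first \<open>j\<close>
    slots count as absent.\<close>
  define P where "P j u = (if u \<in> ?Q ` {1..j} then the_inv_into {1..N} ?Q u else 0)" for j u
  have P_slot: "the_inv_into {Suc 0..N} ?Q (?Q i) = i" if "i \<in> {Suc 0..N}" for i
    using that slots(1) by (simp add: the_inv_into_f_f)
  have P_le: "P j u \<le> j" if "j \<le> N" for j u
    using that by (auto simp: P_def P_slot)
  have P_0: "P 0 = (\<lambda>_. 0)" by (auto simp: P_def)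
  have P_Suc: "P (Suc j) = (P j)(?Q (Suc j) := Suc j)" if "Suc j \<le> N" for j
  proof
    fix u
    have "{1..Suc j} = insert (Suc j) {1..j}" by auto
    then show "P (Suc j) u = ((P j)(?Q (Suc j) := Suc j)) u"
      using that by (auto simp: P_def P_slot)
  qed
  have fresh: "?Q i \<noteq> ?Q (Suc j)" if "Suc j \<le> N" "i \<in> {1..j}" for i j
  proof
    assume "?Q i = ?Q (Suc j)"
    then have "i = Suc j" by (rule inj_onD[OF slots(1)]) (use that in auto)
    with that show False by simp
  qed
  have P_next: "P j (?Q (Suc j)) = 0" if "Suc j \<le> N" for j
  proof -
    have "?Q (Suc j) \<notin> ?Q ` {1..j}" using fresh[OF that] by (metis imageE)
    then show ?thesis by (simp add: P_def)
  qed
  have S0: "\<forall>v. arr \<sigma> 0 v = of_bool (v \<in> S)" "reg \<sigma> 2 < length (qsets \<sigma>)"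
    "qsets \<sigma> ! reg \<sigma> 2 = S"
    using m by (auto simp: maintains_def)

  \<comment> \<open>Parents are known up to \<open>2 * j + 1\<close>, which includes the next
    position \<open>Suc j\<close> and, for \<open>j = 0\<close>, the root.\<close>
  define Inv where "Inv k \<tau> \<longleftrightarrow> (\<exists>j. k = N - j \<and> j \<le> N \<and> reg \<tau> rP = j \<and> reg \<tau> rD = 0 \<and>
    frame ?R ?A \<sigma> \<tau> \<and> arr \<tau> aSlot = ?Q \<and>
    (\<forall>i\<in>{1..j}. arr \<tau> aPos (?Q i) = i) \<and> (\<forall>u. u \<notin> X \<longrightarrow> arr \<tau> aPos u = 0) \<and>
    (\<forall>i\<in>{1..Suc (2 * j)}. arr \<tau> aPar i = i div 2) \<and> tree_ok s t S (P j) j {} \<tau>)" for k \<tau>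

  let ?body = "Add rP rP rOne ;; Store aQ rP 2 ;;
    Add rT rP rP ;; Store aPar rT rP ;; Add rT rT rOne ;; Store aPar rT rP ;;
    Load rX aSlot rP ;; link_code s t"
  have step: "wp U I ?body \<tau> (\<lambda>m \<tau>'. m \<le> 6 * bits N + 19 \<and> (\<exists>k'<k. Inv k' \<tau>'))"
    if inv: "Inv k \<tau>" and less: "reg \<tau> rP < reg \<tau> rN" for k \<tau>
  proof -
    obtain j where j: "k = N - j" "reg \<tau> rP = j" "reg \<tau> rD = 0"
      and fr: "frame ?R ?A \<sigma> \<tau>" and sl: "arr \<tau> aSlot = ?Q"
      and p1: "\<forall>i\<in>{1..j}. arr \<tau> aPos (?Q i) = i" and p0: "\<forall>u. u \<notin> X \<longrightarrow> arr \<tau> aPos u = 0"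
      and par: "\<forall>i\<in>{1..Suc (2 * j)}. arr \<tau> aPar i = i div 2"
      and tree: "tree_ok s t S (P j) j {} \<tau>"
      using inv unfolding Inv_def by blast
    note frD = frameD[OF fr, simplified]
    have jN: "Suc j \<le> N" using less j frD N by simp
    define x where "x = ?Q (Suc j)"
    have xX: "x \<in> X" unfolding slots(2) x_def by (rule imageI) (use jN in simp)
    define \<tau>\<^sub>1 where "\<tau>\<^sub>1 = \<tau>\<lparr>arr := (arr \<tau>)(aQ := (arr \<tau> aQ)(Suc j := reg \<sigma> 2),
        aPar := (arr \<tau> aPar)(Suc j + Suc j := Suc j, Suc (Suc j + Suc j) := Suc j)),
      reg := (reg \<tau>)(rP := Suc j, rT := Suc (Suc j + Suc j), rX := x)\<rparr>"
    have fr1: "frame ?R ?A \<tau> \<tau>\<^sub>1" by (simp add: frame_def \<tau>\<^sub>1_def)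
    have nodes: "node \<tau>\<^sub>1 v = (if v = Suc j then S else node \<tau> v)" for v
      using S0 frD by (simp add: node_def \<tau>\<^sub>1_def)
    \<comment> \<open>All positions in use are at most \<open>j\<close>, so nothing placed so far
      lies below the new node and \<open>S\<close> is its correct set.\<close>
    have "Suc j \<notin> anc (P j u)" for u
      using anc_bounds[of "Suc j" "P j u"] P_le[of j u] jN by auto
    then have tree1: "tree_ok s t S (P j) (Suc j) {} \<tau>\<^sub>1"
      using tree S0 frD unfolding tree_ok_def nodes
      by (auto simp: target_def \<tau>\<^sub>1_def le_Suc_eq)
    have par1: "\<forall>i\<in>{1..Suc (2 * Suc j)}. arr \<tau>\<^sub>1 aPar i = i div 2"
      using par by (auto simp: \<tau>\<^sub>1_def le_Suc_eq)
    have "wp U I (link_code s t) \<tau>\<^sub>1 (\<lambda>m \<tau>'. m \<le> 6 * bits (Suc j) + 12 \<and>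
      frame {rV, rI, rT, rB} {aQ, aPos, aSlot} \<tau>\<^sub>1 \<tau>' \<and>
      arr \<tau>' aPos = (arr \<tau>\<^sub>1 aPos)(x := Suc j) \<and> arr \<tau>' aSlot = (arr \<tau>\<^sub>1 aSlot)(Suc j := x) \<and>
      tree_ok s t S ((P j)(x := Suc j)) (Suc j) {} \<tau>')"
    proof (rule wp_link_code)
      show "x \<in> U \<union> {s, t}" using xX sub(2) by blast
      show "P j x = 0" using P_next[OF jN] by (simp add: x_def)
      show "\<forall>i\<in>{1..Suc j}. arr \<tau>\<^sub>1 aPar i = i div 2" using par1 by auto
    qed (use c frD S0 tree1 in \<open>simp_all add: \<tau>\<^sub>1_def\<close>)
    then have "wp U I (link_code s t) \<tau>\<^sub>1
      (\<lambda>m \<tau>'. m + 7 \<le> 6 * bits N + 19 \<and> (\<exists>k'<k. Inv k' \<tau>'))"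
    proof (elim wp_mono, goal_cases)
      case (1 m \<tau>')
      then have fr2: "frame {rV, rI, rT, rB} {aQ, aPos, aSlot} \<tau>\<^sub>1 \<tau>'" by simp
      note fr2D = frameD[OF fr2, simplified]
      have "frame ?R ?A \<sigma> \<tau>\<^sub>1" by (rule frame_trans[OF fr fr1]) auto
      then have fr3: "frame ?R ?A \<sigma> \<tau>'" by (rule frame_trans[OF _ fr2]) auto
      have pos': "arr \<tau>' aPos = (arr \<tau> aPos)(x := Suc j)" and sl': "arr \<tau>' aSlot = ?Q"
        using 1 sl by (simp_all add: \<tau>\<^sub>1_def x_def)
      have "Inv (N - Suc j) \<tau>'"
        unfolding Inv_def
      proof (intro exI[of _ "Suc j"] conjI)
        show "\<forall>i\<in>{1..Suc j}. arr \<tau>' aPos (?Q i) = i"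
        proof
          fix i assume "i \<in> {1..Suc j}"
          then consider "i \<in> {1..j}" | "i = Suc j" by force
          then show "arr \<tau>' aPos (?Q i) = i"
            using fresh[OF jN] p1 by cases (simp_all add: pos' x_def)
        qed
        show "\<forall>u. u \<notin> X \<longrightarrow> arr \<tau>' aPos u = 0" using p0 xX by (auto simp: pos')
        show "\<forall>i\<in>{1..Suc (2 * Suc j)}. arr \<tau>' aPar i = i div 2" using par1 by (simp add: fr2D)
        show "tree_ok s t S (P (Suc j)) (Suc j) {} \<tau>'" using 1 P_Suc[OF jN] by (simp add: x_def)
      qed (use jN fr3 sl' fr2D j in \<open>simp_all add: \<tau>\<^sub>1_def\<close>)
      moreover have "N - Suc j < k" using j jN by simp
      moreover have "bits (Suc j) \<le> bits N" using jN by (rule bits_mono)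
      ultimately show ?case using 1 by auto
    qed
    then show ?thesis
      using j sl c(2) frD unfolding \<tau>\<^sub>1_def
      by (simp add: x_def) (erule wp_mono; simp)
  qed
  let ?\<sigma>\<^sub>1 = "\<sigma>\<lparr>arr := (arr \<sigma>)(aPar := (arr \<sigma> aPar)(1 := 0), aQ := (arr \<sigma> aQ)(1 := reg \<sigma> 2)),
    reg := (reg \<sigma>)(rD := 0, rP := 0)\<rparr>"
  have "Inv N ?\<sigma>\<^sub>1"
    unfolding Inv_def
  proof (intro exI[of _ 0] conjI)
    \<comment> \<open>Even with no position in use, \<open>tree_ok\<close> speaks about the root;
      its reset ahead of the loop provides this.\<close>
    show "tree_ok s t S (P 0) 0 {} ?\<sigma>\<^sub>1"
      using q S0 by (auto simp: tree_ok_def target_def P_0 node_def)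
  qed (use pos in \<open>auto simp: frame_def\<close>)
  then have "wp U I (While_Less rP rN ?body) ?\<sigma>\<^sub>1 (\<lambda>m \<tau>.
      m \<le> Suc (N * Suc (6 * bits N + 19)) \<and> \<not> reg \<tau> rP < reg \<tau> rN \<and> (\<exists>k. Inv k \<tau>))"
    by (rule wp_While[where Inv = Inv, rotated]) (rule step)
  then show ?thesis
    unfolding rebuild_code_def using c
  proof (simp, elim wp_mono, goal_cases)
    case (1 m' \<tau>)
    then obtain k where "Inv k \<tau>" and mN: "m' \<le> Suc (N * (20 + 6 * bits N))"
      and ge: "\<not> reg \<tau> rP < reg \<tau> rN" by (auto simp: add.commute)
    then obtain j where j: "j \<le> N" "reg \<tau> rP = j" "reg \<tau> rD = 0"
      and fr: "frame ?R ?A \<sigma> \<tau>" and sl: "arr \<tau> aSlot = ?Q"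
      and p1: "\<forall>i\<in>{1..j}. arr \<tau> aPos (?Q i) = i" and p0: "\<forall>u. u \<notin> X \<longrightarrow> arr \<tau> aPos u = 0"
      and par: "\<forall>i\<in>{1..Suc (2 * j)}. arr \<tau> aPar i = i div 2"
      and tree: "tree_ok s t S (P j) j {} \<tau>"
      unfolding Inv_def by blast
    note frD = frameD[OF fr, simplified]
    have jN: "j = N" using j ge frD N by simp
    have "arr \<tau> aPos = P N"
      using p0 p1 slots(2) by (intro ext) (auto simp: P_def jN P_slot)
    moreover have "indexed X N (arr \<tau> aPos) ?Q"
      using p0 p1 slots by (auto simp: indexed_def jN)
    moreover have "dirty \<tau> = {}" using j by (simp add: dirty_def)
    ultimately have "ds_inv U s t S X \<tau>"
      using sub maintains_frame[OF m fr] par tree N jN by (simp add: ds_inv_def frD sl)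
    then show ?case using mN j N frD by (simp add: algebra_simps)
  qed
qed

lemma wp_initialize_code:
  assumes init: "valid_init U I t S q X xs H" and I: "I \<subseteq> Pow U"
  shows "wp U I (initialize_code s t) (init_state S q xs H) (\<lambda>m \<sigma>'.
    m \<le> card X * (6 * bits (card X) + 24) + 11 \<and> ds_inv U s t S X \<sigma>' \<and> reg \<sigma>' rD = 0)"
proof -
  have d: "distinct xs" "set xs = X" and q: "q < length H" "H ! q = S" and S: "S \<subseteq> U"
    and X: "X \<subseteq> U \<union> {s, t}"
    using init I by (auto simp: valid_init_def)
  let ?N = "length xs"
  have N: "card X = ?N" using d distinct_card by force
  let ?\<sigma> = "init_state S q xs H"
  let ?\<sigma>\<^sub>1 = "?\<sigma>\<lparr>reg := (reg ?\<sigma>)(rZ := 0, rOne := 1, 2 := q, rN := ?N, rP := 0)\<rparr>"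
  define Inv where "Inv k \<tau> \<longleftrightarrow> (\<exists>j. k = ?N - j \<and> j \<le> ?N \<and> reg \<tau> rP = j \<and>
    frame {rX, rP} {aSlot} ?\<sigma>\<^sub>1 \<tau> \<and> (\<forall>i<j. arr \<tau> aSlot (Suc i) = xs ! i))" for k \<tau>
  let ?body = "Load rX 1 rP ;; Add rP rP rOne ;; Store aSlot rP rX"
  have step: "wp U I ?body \<tau>
      (\<lambda>m \<tau>'. m \<le> 3 \<and> (\<exists>k'<k. Inv k' \<tau>'))"
    if inv: "Inv k \<tau>" and less: "reg \<tau> rP < reg \<tau> rN" for k \<tau>
  proof -
    obtain j where j: "k = ?N - j" "reg \<tau> rP = j" and fr: "frame {rX, rP} {aSlot} ?\<sigma>\<^sub>1 \<tau>"
      and sl: "\<forall>i<j. arr \<tau> aSlot (Suc i) = xs ! i"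
      using inv unfolding Inv_def by blast
    note frD = frameD[OF fr, simplified]
    have jN: "j < ?N" using less j frD by simp
    let ?\<tau> = "\<tau>\<lparr>reg := (reg \<tau>)(rX := xs ! j, rP := Suc j),
      arr := (arr \<tau>)(aSlot := (arr \<tau> aSlot)(Suc j := xs ! j))\<rparr>"
    have "frame {rX, rP} {aSlot} \<tau> ?\<tau>" by (simp add: frame_def)
    then have "frame {rX, rP} {aSlot} ?\<sigma>\<^sub>1 ?\<tau>" by (rule frame_trans[OF fr]) auto
    then have "Inv (?N - Suc j) ?\<tau>"
      unfolding Inv_def using jN sl by (intro exI[of _ "Suc j"]) (auto simp: less_Suc_eq)
    moreover have "?N - Suc j < k" using j jN by simp
    moreover have "arr \<tau> 1 j = xs ! j" "reg \<tau> rOne = 1"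
      using frD jN by (simp_all add: init_state_def)
    ultimately show ?thesis using j by auto
  qed
  have "Inv ?N ?\<sigma>\<^sub>1" unfolding Inv_def by (intro exI[of _ 0]) (auto simp: frame_def)
  then have "wp U I (While_Less rP rN ?body) ?\<sigma>\<^sub>1 (\<lambda>m \<tau>.
      m \<le> Suc (?N * Suc 3) \<and> \<not> reg \<tau> rP < reg \<tau> rN \<and> (\<exists>k. Inv k \<tau>))"
    by (rule wp_While[where Inv = Inv, rotated]) (rule step)
  then show ?thesis
    unfolding initialize_code_def consts_code_def
  proof (simp add: init_state_def, elim wp_mono, goal_cases)
    case (1 m1 \<tau>)
    then obtain k where "Inv k \<tau>" and m1: "m1 \<le> Suc (?N * 4)"
      and ge: "\<not> reg \<tau> rP < reg \<tau> rN" by (auto simp: eval_nat_numeral)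
    then obtain j where j: "j \<le> ?N" "reg \<tau> rP = j" and fr: "frame {rX, rP} {aSlot} ?\<sigma>\<^sub>1 \<tau>"
      and sl: "\<forall>i<j. arr \<tau> aSlot (Suc i) = xs ! i"
      unfolding Inv_def by blast
    note frD = frameD[OF fr, simplified]
    have jN: "j = ?N" using ge j frD by simp
    \<comment> \<open>The argument list is indexed from 0, the heap from 1.\<close>
    have slots: "arr \<tau> aSlot i = xs ! (i - 1)" if "i \<in> {1..?N}" for i
      using that sl jN by (cases i) auto
    have ms: "maintains S ?\<sigma>\<^sub>1" using q by (simp add: maintains_def init_state_def)
    have "wp U I (rebuild_code s t) \<tau> (\<lambda>m \<sigma>'. m \<le> ?N * (6 * bits ?N + 20) + 5 \<and>
      ds_inv U s t S X \<sigma>' \<and> reg \<sigma>' rN = ?N \<and> reg \<sigma>' rD = 0)"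
    proof (rule wp_rebuild_code)
      show "maintains S \<tau>" by (rule maintains_frame[OF ms fr]) auto
      show "inj_on (arr \<tau> aSlot) {1..?N}"
        using d(1) by (intro inj_onI) (auto simp: slots nth_eq_iff_index_eq)
      show "X = arr \<tau> aSlot ` {1..?N}"
      proof (intro equalityI subsetI)
        fix u assume "u \<in> X"
        then obtain i where "i < ?N" "u = xs ! i" using d(2) by (metis in_set_conv_nth)
        then show "u \<in> arr \<tau> aSlot ` {1..?N}"
          using slots[of "Suc i"] by (intro image_eqI[of _ _ "Suc i"]) simp_all
      next
        fix u assume "u \<in> arr \<tau> aSlot ` {1..?N}"
        then obtain i where i: "i \<in> {1..?N}" "u = xs ! (i - 1)" by (auto simp: slots)
        then have "i - 1 < ?N" by auto
        then show "u \<in> X" using i(2) d(2) by (metis nth_mem)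
      qed
      show "\<forall>u. u \<notin> X \<longrightarrow> arr \<tau> aPos u = 0" "\<forall>v. arr \<tau> aQ v < length (qsets \<tau>)"
        using frD q by (auto simp: init_state_def frame_def)
    qed (use S X frD in auto)
    then show ?case by (rule wp_mono) (use m1 N in \<open>auto simp: algebra_simps\<close>)
  qed
qed

section \<open>Toggling elements of the independent set\<close>

lemma ds_inv_update_reg [simp]:
  assumes "f 2 = reg \<sigma> 2" "f rN = reg \<sigma> rN" "f rD = reg \<sigma> rD"
  shows "ds_inv U s t S X (\<sigma>\<lparr>reg := f\<rparr>) = ds_inv U s t S X \<sigma>"
  using assms by (simp add: ds_inv_def maintains_def)

lemma wp_unless_terminal:
  assumes "reg \<sigma> rX = x" "\<And>k. x \<in> {s, t} \<Longrightarrow> Q (set_reg rT k \<sigma>)"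
    and "x \<notin> {s, t} \<Longrightarrow> wp U I p (set_reg rT t \<sigma>) (\<lambda>m \<sigma>'. m \<le> T \<and> Q \<sigma>')"
  shows "wp U I (unless_terminal s t p) \<sigma> (\<lambda>m \<sigma>'. m \<le> T + 7 \<and> Q \<sigma>')"
proof (cases "x \<in> {s, t}")
  case True
  then show ?thesis using assms(1,2) by (auto simp: unless_terminal_def)
next
  case False
  have "wp U I p (set_reg rT t \<sigma>) (\<lambda>m \<sigma>'. m + 6 \<le> T + 7 \<and> Q \<sigma>')"
    by (rule wp_mono[OF assms(3)[OF False]]) simp
  then show ?thesis
    using False assms(1) unfolding unless_terminal_def by (auto simp: neq_iff intro: wp_mono)
qed

lemma wp_toggle_code:
  assumes inv: "ds_inv U s t S X \<sigma>" and c: "reg \<sigma> rZ = 0" "reg \<sigma> rOne = 1"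
    and d: "reg \<sigma> rX = d" "d \<in> U" "s \<notin> U" "t \<notin> U"
  shows "wp U I toggle_code \<sigma> (\<lambda>m \<sigma>'. m \<le> 14 \<and> ds_inv U s t (sym_diff S {d}) X \<sigma>' \<and>
    frame {2, rB, rT, rI, rD} {0, aQ, aD} \<sigma> \<sigma>' \<and> reg \<sigma>' rD = Suc (reg \<sigma> rD))"
proof -
  define S' where "S' = sym_diff S {d}"
  define b where "b \<longleftrightarrow> d \<notin> S"
  \<comment> \<open>The membership of \<open>d\<close> due at the root: the new one in
    \<open>S\<close>, reversed if \<open>d\<close> belongs to \<open>X\<close>.\<close>
  define r where "r \<longleftrightarrow> b \<noteq> (0 < arr \<sigma> aPos d)"
  let ?l = "length (qsets \<sigma>)"
  let ?A = "if b then S \<union> {d} else S - {d}" let ?B = "if r then node \<sigma> 1 \<union> {d} else node \<sigma> 1 - {d}"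
  have m: "\<forall>v. arr \<sigma> 0 v = of_bool (v \<in> S)" "reg \<sigma> 2 < ?l" "qsets \<sigma> ! reg \<sigma> 2 = S"
    and tree: "tree_ok s t S (arr \<sigma> aPos) (reg \<sigma> rN) (dirty \<sigma>) \<sigma>"
    using inv by (auto simp: ds_inv_def maintains_def)
  then have q: "arr \<sigma> aQ v < ?l" for v by (simp add: tree_ok_def)
  have A: "?A = S'" using b_def by (auto simp: S'_def)
  \<comment> \<open>The four branches, according to membership of \<open>d\<close> in
    \<open>S\<close> and in \<open>X\<close>, end in states of the same form, described by
    \<open>b\<close> and \<open>r\<close>; the invariant is checked once for all of them.\<close>
  have goal: "ds_inv U s t (S') X \<tau> \<and> frame {2, rB, rT, rI, rD} {0, aQ, aD} \<sigma> \<tau>"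
    if reg: "reg \<tau> 2 = ?l" "reg \<tau> rD = Suc (reg \<sigma> rD)"
      "\<And>i. i \<notin> {2, rB, rT, rI, rD} \<Longrightarrow> reg \<tau> i = reg \<sigma> i"
      and arr: "arr \<tau> = (arr \<sigma>)(0 := (arr \<sigma> 0)(d := of_bool b), aQ := (arr \<sigma> aQ)(1 := Suc ?l),
        aD := (arr \<sigma> aD)(reg \<sigma> rD := d))"
      and qs: "qsets \<tau> = qsets \<sigma> @ [?A, ?B]" for \<tau>
  proof -
    have nodes: "node \<tau> v = (if v = 1 then ?B else node \<sigma> v)" for v
      using q[of v] by (auto simp: node_def arr qs nth_append)
    have dirty: "dirty \<tau> = insert d (dirty \<sigma>)"
      by (auto simp: dirty_def reg arr less_Suc_eq)
    have "maintains (S') \<tau>"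
      unfolding A[symmetric] using m(1) by (auto simp: maintains_def reg arr qs nth_append)
    moreover have "tree_ok s t (S') (arr \<tau> aPos) (reg \<tau> rN) (dirty \<tau>) \<tau>"
      unfolding tree_ok_def nodes
    proof (intro conjI allI ballI impI)
      show "arr \<tau> aQ v < length (qsets \<tau>)" for v
        using q[of v] by (simp add: arr qs)
      fix v u assume v: "v \<in> {1..max 1 (reg \<tau> rN)}" and u: "u \<in> dirty \<tau> \<longrightarrow> v = 1"
      then have old: "u \<in> node \<sigma> v \<longleftrightarrow> u \<in> target s t S (arr \<sigma> aPos) v"
        using tree by (simp add: tree_ok_def dirty reg)
      show "(u \<in> (if v = 1 then ?B else node \<sigma> v)) = (u \<in> target s t (S') (arr \<tau> aPos) v)"
      proof (cases "u = d")
        case True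
        \<comment> \<open>As \<open>d\<close> has just been logged, its membership is prescribed
          only at the root.\<close>
        then have "v = 1" using u by (simp add: dirty)
        moreover have "d \<noteq> s" "d \<noteq> t" using d by auto
        ultimately show ?thesis
          using True by (auto simp: S'_def target_def arr root_in_anc_iff r_def b_def)
      next
        case False
        then show ?thesis using old by (auto simp: S'_def target_def arr)
      qed
    qed
    ultimately show ?thesis
      using inv d(2) by (auto simp: S'_def ds_inv_def dirty reg arr frame_def qs)
  qed
  show ?thesis
    unfolding toggle_code_def member_code_def S'_def[symmetric] using c d m q less_SucI[OF q]
    by (cases "d \<in> S"; cases "0 < arr \<sigma> aPos d"; simp; intro goal;
        simp add: b_def r_def node_def nth_append fun_upd_twist)
qed


text \<open>The disjunction carries what the amortization needs: a rebuilding occurs only if the old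
  log and the new entries together reach \<open>\<beta>\<close>, and otherwise the log remains short
  enough for \<open>Find\<close>.\<close>

lemma wp_upd_code:
  assumes inv: "ds_inv U s t S X \<sigma>" and U: "s \<notin> U" "t \<notin> U"
    and ds: "distinct ds" "set ds \<subseteq> U \<union> {s, t}"
    and args: "reg \<sigma> 0 = length ds" "\<forall>j<length ds. arr \<sigma> 1 j = ds ! j"
  shows "wp U I (upd_code \<beta> s t) \<sigma> (\<lambda>m \<sigma>'.
    ds_inv U s t (sym_diff S (set ds - {s, t})) X \<sigma>' \<and> reg \<sigma>' rN = reg \<sigma> rN \<and>
    (reg \<sigma>' rD \<le> reg \<sigma> rD + length ds \<and> reg \<sigma>' rD < \<beta> \<and> m \<le> 24 * length ds + 12 \<or>
     reg \<sigma>' rD = 0 \<and> \<beta> \<le> reg \<sigma> rD + length ds \<and>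
     m \<le> 24 * length ds + 12 + reg \<sigma> rN * (6 * bits (reg \<sigma> rN) + 20)))"
proof -
  let ?n = "length ds" let ?N = "reg \<sigma> rN"
  let ?S = "\<lambda>j. sym_diff S (set (take j ds) - {s, t})"
  let ?\<sigma>\<^sub>1 = "\<sigma>\<lparr>reg := (reg \<sigma>)(rZ := 0, rOne := 1, rP := 0)\<rparr>"
  let ?body = "Load rX 1 rP ;; Add rP rP rOne ;; unless_terminal s t toggle_code"
  define Inv where "Inv k \<tau> \<longleftrightarrow> (\<exists>j. k = ?n - j \<and> j \<le> ?n \<and> reg \<tau> rP = j \<and>
    frame {2, rX, rP, rB, rT, rI, rD} {0, aQ, aD} ?\<sigma>\<^sub>1 \<tau> \<and> reg \<tau> rD \<le> reg \<sigma> rD + j \<and>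
    ds_inv U s t (?S j) X \<tau>)" for k \<tau>
  have step: "wp U I ?body \<tau> (\<lambda>m \<tau>'. m \<le> 23 \<and> (\<exists>k'<k. Inv k' \<tau>'))"
    if inv_j: "Inv k \<tau>" and less: "reg \<tau> rP < reg \<tau> 0" for k \<tau>
  proof -
    obtain j where j: "k = ?n - j" "reg \<tau> rP = j" and rD: "reg \<tau> rD \<le> reg \<sigma> rD + j"
      and fr: "frame {2, rX, rP, rB, rT, rI, rD} {0, aQ, aD} ?\<sigma>\<^sub>1 \<tau>"
      and invj: "ds_inv U s t (?S j) X \<tau>"
      using inv_j unfolding Inv_def by blast
    note frD = frameD[OF fr, simplified]
    have jn: "j < ?n" using less j frD args(1) by simp
    define d where "d = ds ! j"
    have d: "d \<in> U \<union> {s, t}" using ds(2) nth_mem[OF jn] unfolding d_def by blast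
    have take: "set (take (Suc j) ds) = insert d (set (take j ds))"
      using jn by (simp add: take_Suc_conv_app_nth d_def)
    \<comment> \<open>As no entry is repeated, toggling one by one amounts to the symmetric
      difference with the whole set.\<close>
    have fresh: "d \<notin> set (take j ds)"
      using ds(1) jn unfolding d_def by (metis id_take_nth_drop distinct_append disjoint_insert(1) list.set(2))
    define \<tau>\<^sub>1 where "\<tau>\<^sub>1 = \<tau>\<lparr>reg := (reg \<tau>)(rX := d, rP := Suc j)\<rparr>"
    have fr1: "frame {2, rX, rP, rB, rT, rI, rD} {0, aQ, aD} ?\<sigma>\<^sub>1 (set_reg rT i \<tau>\<^sub>1)" for i
      using fr by (simp add: frame_def \<tau>\<^sub>1_def)
    have "wp U I (unless_terminal s t toggle_code) \<tau>\<^sub>1 (\<lambda>m \<tau>'. m \<le> 14 + 7 \<and> Inv (?n - Suc j) \<tau>')"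
    proof (rule wp_unless_terminal)
      show "reg \<tau>\<^sub>1 rX = d" by (simp add: \<tau>\<^sub>1_def)
      fix i assume "d \<in> {s, t}"
      then have "?S (Suc j) = ?S j" by (auto simp: take)
      with invj have "ds_inv U s t (?S (Suc j)) X (set_reg rT i \<tau>\<^sub>1)" by (simp add: \<tau>\<^sub>1_def)
      then show "Inv (?n - Suc j) (set_reg rT i \<tau>\<^sub>1)"
        unfolding Inv_def using jn fr1 rD by (intro exI[of _ "Suc j"]) (simp add: \<tau>\<^sub>1_def)
    next
      assume dst: "d \<notin> {s, t}"
      then have S': "?S (Suc j) = sym_diff (?S j) {d}" using fresh by (auto simp: take)
      have "wp U I toggle_code (set_reg rT t \<tau>\<^sub>1) (\<lambda>m \<sigma>'. m \<le> 14 \<and>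
        ds_inv U s t (sym_diff (?S j) {d}) X \<sigma>' \<and>
        frame {2, rB, rT, rI, rD} {0, aQ, aD} (set_reg rT t \<tau>\<^sub>1) \<sigma>' \<and>
        reg \<sigma>' rD = Suc (reg (set_reg rT t \<tau>\<^sub>1) rD))"
        by (rule wp_toggle_code) (use invj U d dst frD in \<open>simp_all add: \<tau>\<^sub>1_def\<close>)
      then show "wp U I toggle_code (set_reg rT t \<tau>\<^sub>1) (\<lambda>m \<tau>'. m \<le> 14 \<and> Inv (?n - Suc j) \<tau>')"
      proof (rule wp_mono, intro conjI, goal_cases)
        case (2 m \<tau>')
        then have fr2: "frame {2, rB, rT, rI, rD} {0, aQ, aD} (set_reg rT t \<tau>\<^sub>1) \<tau>'" by blast
        have "frame {2, rX, rP, rB, rT, rI, rD} {0, aQ, aD} ?\<sigma>\<^sub>1 \<tau>'"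
          by (rule frame_trans[OF fr1 fr2]) auto
        moreover have "reg \<tau>' rP = Suc j" using frameD[OF fr2] by (simp add: \<tau>\<^sub>1_def)
        moreover have "reg \<tau>' rD \<le> reg \<sigma> rD + Suc j" using 2 rD by (simp add: \<tau>\<^sub>1_def)
        moreover have "ds_inv U s t (?S (Suc j)) X \<tau>'" unfolding S' using 2 by blast
        ultimately show ?case
          unfolding Inv_def using jn by (intro exI[of _ "Suc j"] conjI) simp_all
      qed blast
    qed
    then have "wp U I (unless_terminal s t toggle_code) \<tau>\<^sub>1
        (\<lambda>m \<tau>'. m + 2 \<le> 23 \<and> (\<exists>k'<k. Inv k' \<tau>'))"
      by (rule wp_mono) (use j jn in \<open>auto intro!: exI[of _ "?n - Suc j"]\<close>)
    moreover have "arr \<tau> 1 j = d" "reg \<tau> rOne = 1" using frD args jn by (simp_all add: d_def)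
    ultimately show ?thesis
      using j unfolding \<tau>\<^sub>1_def by simp (erule wp_mono; simp)
  qed
  have "Inv ?n ?\<sigma>\<^sub>1"
    unfolding Inv_def using inv by (intro exI[of _ 0]) (auto simp: frame_def)
  then have "wp U I (While_Less rP 0 ?body) ?\<sigma>\<^sub>1 (\<lambda>m \<tau>.
      m \<le> Suc (?n * Suc 23) \<and> \<not> reg \<tau> rP < reg \<tau> 0 \<and> (\<exists>k. Inv k \<tau>))"
    by (rule wp_While[where Inv = Inv, rotated]) (rule step)
  then show ?thesis
    unfolding upd_code_def consts_code_def
  proof (simp, elim wp_mono, goal_cases)
    case (1 m1 \<tau>)
    then obtain k where "Inv k \<tau>" and m1: "m1 \<le> Suc (?n * 24)"
      and ge: "\<not> reg \<tau> rP < reg \<tau> 0" by (auto simp: eval_nat_numeral)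
    then obtain j where j: "j \<le> ?n" "reg \<tau> rP = j" and rD: "reg \<tau> rD \<le> reg \<sigma> rD + j"
      and fr: "frame {2, rX, rP, rB, rT, rI, rD} {0, aQ, aD} ?\<sigma>\<^sub>1 \<tau>"
      and invj: "ds_inv U s t (?S j) X \<tau>"
      unfolding Inv_def by blast
    note frD = frameD[OF fr, simplified]
    have jn: "j = ?n" using j ge frD args(1) by simp
    let ?S' = "sym_diff S (set ds - {s, t})"
    let ?\<tau> = "set_reg rT \<beta> \<tau>"
    have inv': "ds_inv U s t ?S' X ?\<tau>" using invj by (simp add: jn)
    show ?case
    proof (cases "reg \<tau> rD < \<beta>")
      case True
      then show ?thesis using inv' rD m1 jn frD by simp
    next
      case False
      have idx: "indexed X (reg \<tau> rN) (arr \<tau> aPos) (arr \<tau> aSlot)"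
        using inv' by (simp add: ds_inv_def)
      have "wp U I (rebuild_code s t) ?\<tau> (\<lambda>m \<sigma>'. m \<le> ?N * (6 * bits ?N + 20) + 5 \<and>
        ds_inv U s t ?S' X \<sigma>' \<and> reg \<sigma>' rN = ?N \<and> reg \<sigma>' rD = 0)"
      proof (rule wp_rebuild_code)
        show "inj_on (arr ?\<tau> aSlot) {1..?N}" "X = arr ?\<tau> aSlot ` {1..?N}"
          using indexed_slots[OF idx] frD by simp_all
        show "\<forall>u. u \<notin> X \<longrightarrow> arr ?\<tau> aPos u = 0" using idx by (simp add: indexed_def)
      qed (use inv' frD in \<open>auto simp: ds_inv_def tree_ok_def\<close>)
      then show ?thesis
        using False by simp (erule wp_mono, use m1 rD jn in auto)
    qed
  qed
qed

section \<open>Searching\<close>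

text \<open>\<open>A\<close> stands for the query-set of a node. Candidates outside \<open>S\<close>
  enlarge it, so the reference is the rank of \<open>S\<close>, or of \<open>S - {y}\<close>;
  candidates inside \<open>S\<close> shrink it, so \<open>A\<close> is its own reference and
  \<open>y\<close> is added.\<close>

definition probe :: "nat set set \<Rightarrow> nat \<Rightarrow> nat set \<Rightarrow> nat \<Rightarrow> nat set \<Rightarrow> bool" where
  "probe I s S y A \<longleftrightarrow>
     (if y = s then matroid_rank I S < matroid_rank I A
      else if y \<in> S then matroid_rank I (S - {y}) < matroid_rank I (A - {y})
      else matroid_rank I A < matroid_rank I (A \<union> {y}))"

text \<open>The part \<open>Y\<close> of \<open>X\<close> below \<open>v\<close> contains the
  element at \<open>v\<close> and so is nonempty. If \<open>X\<close> lies outside \<open>S\<close>,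
  the node carries \<open>S \<union> Y\<close> and a gain in rank means that some single element of
  \<open>Y\<close> augments. If \<open>X \<subseteq> S\<close>, it carries \<open>S - Y\<close> and
  \<open>exchange_iff\<close> applies. For \<open>X = {t}\<close> it carries \<open>S\<close>
  itself, and the test asks directly whether \<open>y\<close> augments \<open>S\<close>.\<close>

lemma probe_target_iff:
  assumes M: "matroid U I" and S: "S \<in> I" and U: "s \<notin> U" "t \<notin> U"
    and idx: "indexed X N P Q" and v: "v \<in> {1..N}" and op: "valid_op U I s t S X (Find y)"
  shows "probe I s S y (target s t S P v) \<longleftrightarrow>
    (\<exists>x\<in>X. v \<in> anc (P x) \<and> x \<in> find_results I s t S X y)"
proof -
  define Y where "Y = {x \<in> X. v \<in> anc (P x)}"
  have SU: "S \<subseteq> U" using M S by (auto simp: matroid_def)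
  then have s: "s \<notin> S" "t \<notin> S" using U by auto
  have anc: "v \<in> anc (P u) \<longleftrightarrow> u \<in> Y" for u
    using idx by (cases "u \<in> X") (auto simp: Y_def indexed_def)
  have "Q v \<in> X" "P (Q v) = v" using idx v by (auto simp: indexed_def)
  then have "Q v \<in> Y" using v by (auto simp: Y_def self_in_anc)
  then have ne: "Y \<noteq> {}" by auto
  have YX: "Y \<subseteq> X" by (auto simp: Y_def)
  have tgt: "target s t S P v = sym_diff S (Y - {s, t})"
    unfolding target_def anc by auto
  have "probe I s S y (target s t S P v) \<longleftrightarrow> (\<exists>x\<in>Y. x \<in> find_results I s t S X y)"
  proof (cases "y \<in> S \<union> {s}")
    case True
    then have "y \<notin> U - S" using U by auto
    then have X: "X \<subseteq> U - S" using op by auto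
    then have YS: "Y \<inter> S = {}" "s \<notin> Y" "t \<notin> Y" using YX U by auto
    then have A: "target s t S P v = S \<union> Y" unfolding tgt by auto
    show ?thesis
    proof (cases "y = s")
      case ys: True
      have "S \<union> Y - S = Y" using YS by auto
      then show ?thesis
        using rank_less_iff[OF M S, of "S \<union> Y"] ys YX
        by (auto simp: probe_def A find_results_def)
    next
      case False
      with True have y: "y \<in> S" by auto
      have S': "S - {y} \<in> I" using matroid_subset_indep[OF M S] by blast
      have "S \<union> Y - {y} - (S - {y}) = Y" using YS y by auto
      then show ?thesis
        using rank_less_iff[OF M S', of "S \<union> Y - {y}"] False y YX
        by (auto simp: probe_def A find_results_def)
    qed
  next
    case False
    then have X: "X \<subseteq> S \<or> X = {t}" and y: "y \<in> U" "y \<notin> S" "y \<noteq> s" using op by auto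
    show ?thesis
    proof (cases "X = {t}")
      case True
      then have "Y = {t}" using YX ne by auto
      then have "target s t S P v = S" unfolding tgt using s by auto
      moreover have "matroid_rank I S < matroid_rank I (S \<union> {y}) \<longleftrightarrow> insert y S \<in> I"
        using rank_less_iff[OF M S, of "S \<union> {y}"] y by auto
      ultimately show ?thesis
        using \<open>Y = {t}\<close> True y by (auto simp: probe_def find_results_def)
    next
      case False
      then have YS: "Y \<subseteq> S" using X YX by auto
      then have A: "target s t S P v = S - Y" unfolding tgt using s by auto
      have S': "S - Y \<in> I" using matroid_subset_indep[OF M S] by blast
      have "matroid_rank I (S - Y) < matroid_rank I (S - Y \<union> {y}) \<longleftrightarrow> insert y (S - Y) \<in> I"
        using rank_less_iff[OF M S', of "S - Y \<union> {y}"] y by auto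
      also have "\<dots> \<longleftrightarrow> (\<exists>x\<in>Y. insert y (S - {x}) \<in> I)"
        by (rule exchange_iff[OF M S YS ne y(2)])
      finally show ?thesis
        using False y YX by (auto simp: probe_def A find_results_def)
    qed
  qed
  then show ?thesis by (auto simp: Y_def)
qed

lemma wp_probe_code:
  assumes "reg \<sigma> rZ = 0" "reg \<sigma> rY = y" "y = s \<or> y \<in> U"
    and "maintains S \<sigma>" "reg \<sigma> rI < length (qsets \<sigma>)" "qsets \<sigma> ! reg \<sigma> rI = A"
  shows "wp U I (probe_code s) \<sigma> (\<lambda>m \<sigma>'. m \<le> 9 \<and> frame {rT, rL, rR} {} \<sigma> \<sigma>' \<and>
    (reg \<sigma>' rL < reg \<sigma>' rR \<longleftrightarrow> probe I s S y A))"
proof -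
  have S: "\<forall>v. arr \<sigma> 0 v = of_bool (v \<in> S)" "reg \<sigma> 2 < length (qsets \<sigma>)" "qsets \<sigma> ! reg \<sigma> 2 = S"
    using assms(4) by (auto simp: maintains_def)
  show ?thesis
  proof (cases "y = s")
    case True
    then show ?thesis
      unfolding probe_code_def using assms S by (simp add: probe_def frame_def)
  next
    case False
    then have "y < s \<or> s < y" "y \<in> U" using assms(3) by auto
    then show ?thesis
      unfolding probe_code_def using assms S less_SucI[OF assms(5)]
      by (cases "y \<in> S"; elim disjE) (auto simp: probe_def frame_def nth_append)
  qed
qed

text \<open>Positions decrease on the way to the root, so the first one that is at most
  \<open>v\<close> decides whether \<open>v\<close> lies on the path.\<close>

lemma wp_climb:
  assumes "reg \<sigma> rC = v" "reg \<sigma> rT = p" "1 \<le> v" "\<forall>j\<in>{1..p}. arr \<sigma> aPar j = j div 2"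
  shows "wp U I (While_Less rC rT (Load rT aPar rT)) \<sigma> (\<lambda>m \<sigma>'. m \<le> Suc (2 * bits p) \<and>
    frame {rT} {} \<sigma> \<sigma>' \<and> reg \<sigma>' rT \<le> v \<and> (reg \<sigma>' rT = v \<longleftrightarrow> v \<in> anc p))"
  using assms
proof (induction p arbitrary: \<sigma> rule: less_induct)
  case (less p)
  show ?case
  proof (cases "v < p")
    case False
    then have "v \<in> anc p \<longleftrightarrow> p = v" using less.prems(3) anc_bounds[of v p] self_in_anc[of p] by auto
    then show ?thesis
      using False less.prems by (subst wp_While_iff) (simp add: frame_def)
  next
    case True
    let ?\<tau> = "set_reg rT (p div 2) \<sigma>"
    have p: "0 < p" "v \<in> anc p \<longleftrightarrow> v \<in> anc (p div 2)" "arr \<sigma> aPar p = p div 2"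
      using True less.prems(4) by (auto simp: anc_pos)
    have fr: "frame {rT} {} \<sigma> ?\<tau>" by (simp add: frame_def)
    have "wp U I (While_Less rC rT (Load rT aPar rT)) ?\<tau> (\<lambda>m \<sigma>'. m \<le> Suc (2 * bits (p div 2)) \<and>
      frame {rT} {} ?\<tau> \<sigma>' \<and> reg \<sigma>' rT \<le> v \<and> (reg \<sigma>' rT = v \<longleftrightarrow> v \<in> anc (p div 2)))"
      by (rule less.IH) (use less.prems p in auto)
    then have "wp U I (While_Less rC rT (Load rT aPar rT)) ?\<tau> (\<lambda>m \<sigma>'. m + 2 \<le> Suc (2 * bits p) \<and>
      frame {rT} {} \<sigma> \<sigma>' \<and> reg \<sigma>' rT \<le> v \<and> (reg \<sigma>' rT = v \<longleftrightarrow> v \<in> anc p))"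
      by (rule wp_mono) (use p in \<open>auto simp: bits_pos intro: frame_trans[OF fr]\<close>)
    then show ?thesis
      using True less.prems p by (subst wp_While_iff) (simp, erule wp_mono, simp)
  qed
qed

lemma wp_refresh_code:
  assumes c: "reg \<sigma> rZ = 0" "reg \<sigma> rOne = 1" and inv: "ds_inv U s t S X \<sigma>"
    and U: "s \<notin> U" "t \<notin> U" and v: "reg \<sigma> rC = v" "v \<in> {1..reg \<sigma> rN}"
  shows "wp U I refresh_code \<sigma> (\<lambda>m \<sigma>'. m \<le> reg \<sigma> rD * (2 * bits (reg \<sigma> rN) + 10) + 3 \<and>
    frame {rI, rP, rX, rB, rT} {} \<sigma> \<sigma>' \<and> reg \<sigma>' rI < length (qsets \<sigma>') \<and>
    qsets \<sigma>' ! reg \<sigma>' rI = target s t S (arr \<sigma> aPos) v)"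
proof -
  let ?R = "{rI, rP, rX, rB, rT}" let ?n = "reg \<sigma> rD" let ?T = "target s t S (arr \<sigma> aPos) v"
  have idx: "indexed X (reg \<sigma> rN) (arr \<sigma> aPos) (arr \<sigma> aSlot)" and ms: "maintains S \<sigma>"
    and par: "\<forall>j\<in>{1..reg \<sigma> rN}. arr \<sigma> aPar j = j div 2"
    and tree: "tree_ok s t S (arr \<sigma> aPos) (reg \<sigma> rN) (dirty \<sigma>) \<sigma>"
    and dU: "dirty \<sigma> \<subseteq> U"
    using inv by (auto simp: ds_inv_def)
  have pos: "arr \<sigma> aPos u \<le> reg \<sigma> rN" for u
    using idx by (cases "u \<in> X") (auto simp: indexed_def)
  let ?\<sigma>\<^sub>1 = "\<sigma>\<lparr>reg := (reg \<sigma>)(rI := arr \<sigma> aQ v, rP := 0)\<rparr>"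
  let ?body = "Load rX aD rP ;; Add rP rP rOne ;; Load rB 0 rX ;; Load rT aPos rX ;;
         While_Less rC rT (Load rT aPar rT) ;;
         If_Less rT rC Skip (Sub rB rOne rB) ;;
         member_code rI"
  \<comment> \<open>Elements of the entries from \<open>j\<close> on are still exempt. An element
    logged repeatedly stays exempt until its last entry, but every treatment already writes its
    correct membership.\<close>
  define Inv where "Inv k \<tau> \<longleftrightarrow> (\<exists>j. k = ?n - j \<and> j \<le> ?n \<and> reg \<tau> rP = j \<and>
    frame ?R {} \<sigma> \<tau> \<and> reg \<tau> rI < length (qsets \<tau>) \<and>
    (\<forall>u. u \<notin> arr \<sigma> aD ` {j..<?n} \<longrightarrow> (u \<in> qsets \<tau> ! reg \<tau> rI \<longleftrightarrow> u \<in> ?T)))" for k \<tau>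
  have step: "wp U I ?body \<tau> (\<lambda>m \<tau>'. m \<le> 2 * bits (reg \<sigma> rN) + 9 \<and> (\<exists>k'<k. Inv k' \<tau>'))"
    if inv_j: "Inv k \<tau>" and less: "reg \<tau> rP < reg \<tau> rD" for k \<tau>
  proof -
    obtain j where j: "k = ?n - j" "reg \<tau> rP = j" and fr: "frame ?R {} \<sigma> \<tau>"
      and I: "reg \<tau> rI < length (qsets \<tau>)"
      and A: "\<forall>u. u \<notin> arr \<sigma> aD ` {j..<?n} \<longrightarrow> (u \<in> qsets \<tau> ! reg \<tau> rI \<longleftrightarrow> u \<in> ?T)"
      using inv_j unfolding Inv_def by blast
    note frD = frameD[OF fr, simplified]
    have jn: "j < ?n" using less j frD by simp
    define d where "d = arr \<sigma> aD j"
    have "d \<in> dirty \<sigma>" using jn by (auto simp: d_def dirty_def)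
    then have d: "d \<in> U" "d \<noteq> s" "d \<noteq> t" using dU U by auto
    define p where "p = arr \<sigma> aPos d"
    let ?\<tau> = "\<tau>\<lparr>reg := (reg \<tau>)(rX := d, rP := Suc j, rB := of_bool (d \<in> S), rT := p)\<rparr>"
    have fr1: "frame ?R {} \<sigma> ?\<tau>" using fr by (simp add: frame_def)
    have "wp U I (While_Less rC rT (Load rT aPar rT)) ?\<tau> (\<lambda>m \<sigma>'. m \<le> Suc (2 * bits p) \<and>
      frame {rT} {} ?\<tau> \<sigma>' \<and> reg \<sigma>' rT \<le> v \<and> (reg \<sigma>' rT = v \<longleftrightarrow> v \<in> anc p))"
      by (rule wp_climb) (use frD v par pos[of d] in \<open>auto simp: p_def\<close>)
    moreover have "reg \<tau> rOne = 1" "arr \<tau> aD j = d" "arr \<tau> 0 d = of_bool (d \<in> S)"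
      "arr \<tau> aPos d = p"
      using frD c ms by (simp_all add: d_def p_def maintains_def)
    ultimately show ?thesis using j(2)
    proof (simp split del: split_of_bool, elim wp_mono, goal_cases)
      case (1 m \<rho>)
      then have fr2: "frame {rT} {} ?\<tau> \<rho>" by blast
      note frD2 = frameD[OF fr2, simplified]
      have fr3: "frame ?R {} \<sigma> \<rho>" by (rule frame_trans[OF fr1 fr2]) auto
      have "bits p \<le> bits (reg \<sigma> rN)" unfolding p_def by (rule bits_mono[OF pos])
      then have m: "m \<le> Suc (2 * bits (reg \<sigma> rN))" using 1 by linarith
      let ?b = "(d \<in> S) \<noteq> (v \<in> anc p)"
      let ?q = "qsets \<rho> ! reg \<rho> rI"
      have I': "reg \<rho> rI < length (qsets \<rho>)" "?q = qsets \<tau> ! reg \<tau> rI"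
        using frD2 I by auto
      have regs: "reg \<rho> rX = d" "reg \<rho> rZ = 0" "reg \<rho> rOne = 1" "reg \<rho> rC = v"
        "reg \<rho> rB = of_bool (d \<in> S)" "reg \<rho> rP = Suc j"
        using frD2 frD c v by simp_all
      have final: "\<exists>k'<k. Inv k' \<rho>'"
        if R: "\<And>r. r \<notin> {rB, rI} \<Longrightarrow> reg \<rho>' r = reg \<rho> r" "reg \<rho>' rI = length (qsets \<rho>)"
          and "arr \<rho>' = arr \<rho>" "qsets \<rho>' = qsets \<rho> @ [B]"
          and B: "B = (if ?b then ?q \<union> {d} else ?q - {d})" for \<rho>' B
      proof -
        have "frame {rB, rI} {} \<rho> \<rho>'" using that by (simp add: frame_def)
        then have fr4: "frame ?R {} \<sigma> \<rho>'" by (rule frame_trans[OF fr3]) auto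
        have "d \<in> ?T \<longleftrightarrow> ?b" using d by (simp add: target_def p_def)
        moreover have "{j..<?n} = insert j {Suc j..<?n}" using jn by auto
        ultimately have "u \<in> B \<longleftrightarrow> u \<in> ?T" if "u \<notin> arr \<sigma> aD ` {Suc j..<?n}" for u
          using A that unfolding B I'(2) by (cases "u = d") (auto simp: d_def)
        then have "Inv (?n - Suc j) \<rho>'"
          unfolding Inv_def using that(1-4) fr4 jn regs
          by (intro exI[of _ "Suc j"]) (auto simp: R)
        then show ?thesis using j jn by (intro exI[of _ "?n - Suc j"]) simp
      qed
      have lt: "reg \<rho> rT < v \<longleftrightarrow> v \<notin> anc p" using 1 by (auto simp: le_less)
      show ?case
        unfolding member_code_def using regs I' m d(1) lt
        by (cases "d \<in> S"; cases "v \<in> anc p"; simp; intro final; simp)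
    qed
  qed
  have "Inv ?n ?\<sigma>\<^sub>1"
    unfolding Inv_def
  proof (intro exI[of _ 0] conjI)
    show "\<forall>u. u \<notin> arr \<sigma> aD ` {0..<?n} \<longrightarrow>
        (u \<in> qsets ?\<sigma>\<^sub>1 ! reg ?\<sigma>\<^sub>1 rI \<longleftrightarrow> u \<in> ?T)"
      using tree v by (auto simp: tree_ok_def dirty_def node_def lessThan_atLeast0)
  qed (use tree in \<open>auto simp: frame_def tree_ok_def\<close>)
  then have "wp U I (While_Less rP rD ?body) ?\<sigma>\<^sub>1 (\<lambda>m \<tau>.
      m \<le> Suc (?n * Suc (2 * bits (reg \<sigma> rN) + 9)) \<and> \<not> reg \<tau> rP < reg \<tau> rD \<and> (\<exists>k. Inv k \<tau>))"
    by (rule wp_While[where Inv = Inv, rotated]) (rule step)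
  then show ?thesis
    unfolding refresh_code_def using v(1)
  proof (simp, elim wp_mono, goal_cases)
    case (1 m \<tau>)
    then obtain k where "Inv k \<tau>" and m: "m \<le> Suc (?n * (2 * bits (reg \<sigma> rN) + 10))"
      and ge: "\<not> reg \<tau> rP < reg \<tau> rD" by (auto simp: add.commute)
    then obtain j where j: "j \<le> ?n" "reg \<tau> rP = j" and fr: "frame ?R {} \<sigma> \<tau>"
      and I: "reg \<tau> rI < length (qsets \<tau>)"
      and A: "\<forall>u. u \<notin> arr \<sigma> aD ` {j..<?n} \<longrightarrow> (u \<in> qsets \<tau> ! reg \<tau> rI \<longleftrightarrow> u \<in> ?T)"
      unfolding Inv_def by blast
    have "j = ?n" using j ge frameD[OF fr] by simp
    then show ?case using m fr I A by auto
  qed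
qed

text \<open>With the arrays unchanged, stored indices still point to the same sets. This applies to
  auxiliary sets created by \<open>Find\<close> as well as to those added by the caller between
  operations.\<close>

lemma ds_inv_frame:
  assumes "ds_inv U s t S X \<sigma>" "frame R {} \<sigma> \<sigma>'" "R \<inter> {2, rN, rD} = {}"
  shows "ds_inv U s t S X \<sigma>'"
proof -
  have R: "2 \<notin> R" "rN \<notin> R" "rD \<notin> R" using assms(3) by auto
  note frD = frameD[OF assms(2), simplified]
  have q: "arr \<sigma> aQ v < length (qsets \<sigma>)" for v
    using assms(1) by (simp add: ds_inv_def tree_ok_def)
  then have "node \<sigma>' = node \<sigma>" using frD by (auto simp: node_def)
  moreover have "maintains S \<sigma>'"
    using assms(1) R by (intro maintains_frame[OF _ assms(2)]) (auto simp: ds_inv_def)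
  moreover have "dirty \<sigma>' = dirty \<sigma>" using dirty_frame[OF assms(2)] R by simp
  ultimately show ?thesis
    using assms(1) R q by (simp add: ds_inv_def tree_ok_def frD)
qed

lemma wp_try_code:
  assumes c: "reg \<sigma> rZ = 0" "reg \<sigma> rOne = 1" and inv: "ds_inv U s t S X \<sigma>"
    and U: "s \<notin> U" "t \<notin> U" and v: "reg \<sigma> rC = v" "1 \<le> v"
    and y: "reg \<sigma> rY = y" "y = s \<or> y \<in> U" and g: "reg \<sigma> rG = 0"
  shows "wp U I (try_code s) \<sigma> (\<lambda>m \<sigma>'. m \<le> reg \<sigma> rD * (2 * bits (reg \<sigma> rN) + 10) + 17 \<and>
    frame {rI, rP, rX, rB, rT, rL, rR, rV, rG} {} \<sigma> \<sigma>' \<and>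
    (if v \<le> reg \<sigma> rN \<and> probe I s S y (target s t S (arr \<sigma> aPos) v)
     then reg \<sigma>' rV = v \<and> reg \<sigma>' rG = 1 else reg \<sigma>' rV = reg \<sigma> rV \<and> reg \<sigma>' rG = 0))"
proof (cases "reg \<sigma> rN < v")
  case True
  then show ?thesis using v g by (simp add: try_code_def frame_def)
next
  case False
  let ?A = "target s t S (arr \<sigma> aPos) v"
  have "wp U I refresh_code \<sigma> (\<lambda>m \<sigma>'. m \<le> reg \<sigma> rD * (2 * bits (reg \<sigma> rN) + 10) + 3 \<and>
    frame {rI, rP, rX, rB, rT} {} \<sigma> \<sigma>' \<and> reg \<sigma>' rI < length (qsets \<sigma>') \<and>
    qsets \<sigma>' ! reg \<sigma>' rI = ?A)"
    using False v by (intro wp_refresh_code[OF c inv U v(1)]) simp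
  then show ?thesis
    unfolding try_code_def using False v(1)
  proof (simp, elim wp_mono, goal_cases)
    case hyp: (1 m1 \<sigma>\<^sub>1)
    then have fr1: "frame {rI, rP, rX, rB, rT} {} \<sigma> \<sigma>\<^sub>1" and m1: "m1 \<le> reg \<sigma> rD * (2 * bits (reg \<sigma> rN) + 10) + 3"
      by blast+
    note frD1 = frameD[OF fr1, simplified]
    have "wp U I (probe_code s) \<sigma>\<^sub>1 (\<lambda>m \<sigma>'. m \<le> 9 \<and> frame {rT, rL, rR} {} \<sigma>\<^sub>1 \<sigma>' \<and>
      (reg \<sigma>' rL < reg \<sigma>' rR \<longleftrightarrow> probe I s S y ?A))"
      by (rule wp_probe_code)
        (use hyp c y frD1 ds_inv_frame[OF inv fr1] in \<open>auto simp: ds_inv_def\<close>)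
    then show ?case
    proof (simp only: wp_Seq, elim wp_mono, goal_cases)
      case (1 m2 \<sigma>\<^sub>2)
      then have fr2: "frame {rT, rL, rR} {} \<sigma>\<^sub>1 \<sigma>\<^sub>2" by blast
      note frD2 = frameD[OF fr2, simplified]
      have "frame {rI, rP, rX, rB, rT, rL, rR, rV, rG} {} \<sigma> \<sigma>\<^sub>2"
        by (rule frame_trans[OF fr1 fr2]) auto
      moreover from this have "frame {rI, rP, rX, rB, rT, rL, rR, rV, rG} {} \<sigma>
          (\<sigma>\<^sub>2\<lparr>reg := (reg \<sigma>\<^sub>2)(rV := v, rG := Suc 0)\<rparr>)"
        by (simp add: frame_def)
      ultimately show ?case
        using 1 False v g frD1 frD2 m1
        by (cases "probe I s S y ?A") simp_all
    qed
  qed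
qed

text \<open>\<open>F v\<close> abstracts the property that the subtree of \<open>v\<close> contains
  an answer. If both children fail the test, \<open>children\<close> makes the element at the
  current node an answer. A move to a child raises \<open>bits\<close> by one, so there are at most
  \<open>bits N\<close> rounds of at most two attempts, where \<open>N\<close> is the size of the
  heap.\<close>

lemma wp_descend_code:
  assumes c: "reg \<sigma> rZ = 0" "reg \<sigma> rOne = 1" and inv: "ds_inv U s t S X \<sigma>"
    and U: "s \<notin> U" "t \<notin> U" and y: "reg \<sigma> rY = y" "y = s \<or> y \<in> U"
    and start: "reg \<sigma> rV = 1" "reg \<sigma> rG = 1" "1 \<le> reg \<sigma> rN" "F 1"
    and F: "\<And>v. v \<in> {1..reg \<sigma> rN} \<Longrightarrow> probe I s S y (target s t S (arr \<sigma> aPos) v) \<longleftrightarrow> F v"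
    and children: "\<And>v. v \<in> {1..reg \<sigma> rN} \<Longrightarrow> F v \<Longrightarrow> arr \<sigma> aSlot v \<in> Res \<or>
      2 * v \<le> reg \<sigma> rN \<and> F (2 * v) \<or> Suc (2 * v) \<le> reg \<sigma> rN \<and> F (Suc (2 * v))"
  shows "wp U I (descend_code s) \<sigma> (\<lambda>m \<sigma>'.
    m \<le> Suc (bits (reg \<sigma> rN) * (2 * (reg \<sigma> rD * (2 * bits (reg \<sigma> rN) + 10)) + 40)) \<and>
    frame {rI, rP, rX, rB, rT, rL, rR, rV, rG, rC} {} \<sigma> \<sigma>' \<and> arr \<sigma> aSlot (reg \<sigma>' rV) \<in> Res)"
proof -
  let ?R = "{rI, rP, rX, rB, rT, rL, rR, rV, rG, rC}" let ?N = "reg \<sigma> rN"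
  let ?R' = "{rI, rP, rX, rB, rT, rL, rR, rV, rG}"
  let ?t = "reg \<sigma> rD * (2 * bits ?N + 10)"
  let ?body = "Const rG 0 ;; Add rC rV rV ;; try_code s ;;
      If_Less rG rOne (Add rC rC rOne ;; try_code s) Skip"
  let ?hit = "\<lambda>v. v \<le> ?N \<and> F v"
  \<comment> \<open>The flag \<open>rG\<close> separates a running descent from a finished one;
    variant 0 is reserved for the latter, so the round that finds the answer decreases it
    too.\<close>
  define Inv where "Inv k \<tau> \<longleftrightarrow> frame ?R {} \<sigma> \<tau> \<and> reg \<tau> rV \<in> {1..?N} \<and> F (reg \<tau> rV) \<and>
    (reg \<tau> rG = 1 \<and> k = Suc (bits ?N - bits (reg \<tau> rV)) \<or>
     reg \<tau> rG = 0 \<and> k = 0 \<and> arr \<sigma> aSlot (reg \<tau> rV) \<in> Res)" for k \<tau>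
  have attempt: "wp U I (try_code s) \<tau> (\<lambda>m \<tau>'. m \<le> ?t + 17 \<and> frame ?R' {} \<tau> \<tau>' \<and>
      (if ?hit v then reg \<tau>' rV = v \<and> reg \<tau>' rG = 1 else reg \<tau>' rV = reg \<tau> rV \<and> reg \<tau>' rG = 0))"
    if fr: "frame ?R {} \<sigma> \<tau>" and v: "reg \<tau> rC = v" "1 \<le> v" "reg \<tau> rG = 0" for \<tau> v
  proof -
    note frD = frameD[OF fr, simplified]
    have inv': "ds_inv U s t S X \<tau>" by (rule ds_inv_frame[OF inv fr]) auto
    show ?thesis
      by (rule wp_mono[OF wp_try_code[OF _ _ inv' U v(1,2) _ y(2) v(3)]])
        (use frD c y F[of v] v(2) in \<open>auto split: if_splits\<close>)
  qed
  have step: "wp U I ?body \<tau> (\<lambda>m \<tau>'. m \<le> 2 * ?t + 39 \<and> (\<exists>k'<k. Inv k' \<tau>'))"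
    if inv_k: "Inv k \<tau>" and less: "reg \<tau> rZ < reg \<tau> rG" for k \<tau>
  proof -
    define v where "v = reg \<tau> rV"
    have fr: "frame ?R {} \<sigma> \<tau>" and v: "v \<in> {1..?N}" "F v" and k: "k = Suc (bits ?N - bits v)"
      using inv_k less unfolding Inv_def v_def by auto
    let ?\<tau>\<^sub>1 = "\<tau>\<lparr>reg := (reg \<tau>)(rG := 0, rC := v + v)\<rparr>"
    have fr1: "frame ?R {} \<sigma> ?\<tau>\<^sub>1" using fr by (simp add: frame_def)
    have bits: "bits ?N - bits w < bits ?N - bits v" if "w = 2 * v \<or> w = Suc (2 * v)" "w \<le> ?N" for w
      using that bits_children[of v] bits_mono[OF that(2)] v(1) by auto
    have descend: "\<exists>k'<k. Inv k' \<rho>"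
      if "frame ?R {} \<sigma> \<rho>" "reg \<rho> rV = w" "reg \<rho> rG = 1" "?hit w" "w = 2 * v \<or> w = Suc (2 * v)"
      for \<rho> w
      unfolding Inv_def using that bits[of w] k v(1)
      by (intro exI[of _ "Suc (bits ?N - bits w)"]) auto
    have "wp U I (try_code s) ?\<tau>\<^sub>1 (\<lambda>m \<tau>'. m \<le> ?t + 17 \<and> frame ?R' {} ?\<tau>\<^sub>1 \<tau>' \<and>
      (if ?hit (2 * v) then reg \<tau>' rV = 2 * v \<and> reg \<tau>' rG = 1
       else reg \<tau>' rV = reg ?\<tau>\<^sub>1 rV \<and> reg \<tau>' rG = 0))"
      using v by (intro attempt[OF fr1]) auto
    then show ?thesis
    proof (simp add: v_def[symmetric], elim wp_mono, goal_cases)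
      case (1 m2 \<tau>\<^sub>2)
      then have fr2: "frame ?R' {} ?\<tau>\<^sub>1 \<tau>\<^sub>2" and m2: "m2 \<le> ?t + 17" by auto
      note frD2 = frameD[OF fr2, simplified]
      have fr3: "frame ?R {} \<sigma> \<tau>\<^sub>2" by (rule frame_trans[OF fr1 fr2]) auto
      note frD3 = frameD[OF fr3, simplified]
      show ?case
      proof (cases "?hit (2 * v)")
        case True
        then have "reg \<tau>\<^sub>2 rV = 2 * v" "reg \<tau>\<^sub>2 rG = 1" using 1 by simp_all
        then show ?thesis using descend[OF fr3 _ _ True] frD3 c m2 by simp
      next
        case False
        then have r2: "reg \<tau>\<^sub>2 rV = v" "reg \<tau>\<^sub>2 rG = 0" using 1 by (auto simp: v_def)
        let ?\<tau>\<^sub>3 = "set_reg rC (Suc (2 * v)) \<tau>\<^sub>2"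
        have fr4: "frame ?R {} \<sigma> ?\<tau>\<^sub>3" using fr3 by (simp add: frame_def)
        have "wp U I (try_code s) ?\<tau>\<^sub>3 (\<lambda>m \<tau>'. m \<le> ?t + 17 \<and> frame ?R' {} ?\<tau>\<^sub>3 \<tau>' \<and>
          (if ?hit (Suc (2 * v)) then reg \<tau>' rV = Suc (2 * v) \<and> reg \<tau>' rG = 1
           else reg \<tau>' rV = reg ?\<tau>\<^sub>3 rV \<and> reg \<tau>' rG = 0))"
          using r2 by (intro attempt[OF fr4]) auto
        then have "wp U I (try_code s) ?\<tau>\<^sub>3 (\<lambda>m \<tau>'. m + m2 + 5 \<le> 2 * ?t + 39 \<and> (\<exists>k'<k. Inv k' \<tau>'))"
        proof (rule wp_mono, goal_cases)
          case (1 m4 \<tau>\<^sub>4)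
          then have fr5: "frame ?R' {} ?\<tau>\<^sub>3 \<tau>\<^sub>4" by blast
          have fr6: "frame ?R {} \<sigma> \<tau>\<^sub>4" by (rule frame_trans[OF fr4 fr5]) auto
          have "\<exists>k'<k. Inv k' \<tau>\<^sub>4"
          proof (cases "?hit (Suc (2 * v))")
            case True
            then show ?thesis using 1 descend[OF fr6 _ _ True] by simp
          next
            case no: False
            then have "reg \<tau>\<^sub>4 rV = v" "reg \<tau>\<^sub>4 rG = 0" using 1 r2 by auto
            moreover have "arr \<sigma> aSlot v \<in> Res" using children[OF v] no False by blast
            ultimately have "Inv 0 \<tau>\<^sub>4" unfolding Inv_def using fr6 v by auto
            then show ?thesis using k by blast
          qed
          then show ?case using 1 m2 by simp
        qed
        moreover have "reg \<tau>\<^sub>2 rC = 2 * v" "reg \<tau>\<^sub>2 rOne = 1" using frD2 frD3 c by auto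
        ultimately show ?thesis
          using r2 by simp (erule wp_mono; simp)
      qed
    qed
  qed
  \<comment> \<open>The root is at level 1, so the initial variant \<open>Suc (bits ?N - 1)\<close>
    equals \<open>bits ?N\<close>.\<close>
  have b1: "bits 1 = 1" by (simp add: bits_pos)
  then have bN: "1 \<le> bits ?N" using bits_mono[OF start(3)] by simp
  have "Inv (bits ?N) \<sigma>"
    unfolding Inv_def using start b1 bN by (auto simp: frame_def)
  then have "wp U I (While_Less rZ rG ?body) \<sigma> (\<lambda>m \<tau>.
      m \<le> Suc (bits ?N * Suc (2 * ?t + 39)) \<and> \<not> reg \<tau> rZ < reg \<tau> rG \<and> (\<exists>k. Inv k \<tau>))"
    by (rule wp_While[where Inv = Inv, rotated]) (rule step)
  then show ?thesis
    unfolding descend_code_def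
  proof (rule wp_mono, goal_cases)
    case (1 m \<tau>)
    then obtain k where k: "Inv k \<tau>" by blast
    then have fr: "frame ?R {} \<sigma> \<tau>" unfolding Inv_def by blast
    then have "reg \<tau> rZ = 0" using frameD(1)[OF fr] c by simp
    then show ?case using 1 k unfolding Inv_def by (auto simp: add.commute)
  qed
qed

section \<open>Correctness and cost of a complete search\<close>

lemma find_results_subset: "find_results I s t S X y \<subseteq> X"
  by (auto simp: find_results_def)

lemma wp_search_code:
  assumes M: "matroid U I" and S: "S \<in> I" and inv: "ds_inv U s t S X \<sigma>"
    and U: "s \<notin> U" "t \<notin> U" and y: "reg \<sigma> 0 = y" and op: "valid_op U I s t S X (Find y)"
  shows "wp U I (search_code s) \<sigma> (\<lambda>m \<sigma>'.
    ds_inv U s t S X \<sigma>' \<and> reg \<sigma>' rN = reg \<sigma> rN \<and> reg \<sigma>' rD = reg \<sigma> rD \<and>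
    (case find_answer \<sigma>' of None \<Rightarrow> find_results I s t S X y = {} \<and> m \<le> 20
     | Some x \<Rightarrow> x \<in> find_results I s t S X y \<and>
        m \<le> bits (reg \<sigma> rN) * (2 * (reg \<sigma> rD * (2 * bits (reg \<sigma> rN) + 10)) + 40) + 25))"
proof -
  let ?N = "reg \<sigma> rN" let ?Res = "find_results I s t S X y" let ?P = "arr \<sigma> aPos"
  let ?t = "bits ?N * (2 * (reg \<sigma> rD * (2 * bits ?N + 10)) + 40)"
  define F where "F v \<longleftrightarrow> (\<exists>x\<in>X. v \<in> anc (?P x) \<and> x \<in> ?Res)" for v
  have idx: "indexed X ?N ?P (arr \<sigma> aSlot)"
    and tree: "tree_ok s t S ?P ?N (dirty \<sigma>) \<sigma>"
    using inv by (auto simp: ds_inv_def)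
  have SU: "S \<subseteq> U" using inv by (simp add: ds_inv_def)
  have yU: "y = s \<or> y \<in> U" using op SU by auto
  let ?\<sigma>\<^sub>1 = "\<sigma>\<lparr>reg := (reg \<sigma>)(rZ := 0, rOne := 1, rY := y)\<rparr>"
  have inv1: "ds_inv U s t S X ?\<sigma>\<^sub>1" using inv by simp
  show ?thesis
  proof (cases "?N = 0")
    case True
    \<comment> \<open>An empty heap needs its own test: its root would carry \<open>S\<close>, and
      probing it would report success whenever \<open>S \<union> {y}\<close> is independent,
      although no candidate exists.\<close>
    then have "X = {}" using indexed_slots(1)[OF idx] by simp
    then have "?Res = {}" using find_results_subset by blast
    then show ?thesis
      unfolding search_code_def consts_code_def using True y inv
      by (simp add: find_answer_def)
  next
    case False
    let ?\<sigma>\<^sub>2 = "\<sigma>\<lparr>reg := (reg \<sigma>)(rZ := 0, rOne := 1, rY := y, rI := arr \<sigma> aQ 1)\<rparr>"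
    have inv2: "ds_inv U s t S X ?\<sigma>\<^sub>2" using inv by simp
    have probe_F: "probe I s S y (target s t S ?P v) \<longleftrightarrow> F v" if "v \<in> {1..?N}" for v
      unfolding F_def by (rule probe_target_iff[OF M S U idx that op])
    have F_root: "F 1 \<longleftrightarrow> ?Res \<noteq> {}"
    proof -
      have "1 \<in> anc (?P x)" if "x \<in> X" for x
        using idx that by (auto simp: indexed_def root_in_anc_iff)
      then show ?thesis using find_results_subset[of I s t S X y] unfolding F_def by blast
    qed
    have children: "arr \<sigma> aSlot v \<in> ?Res \<or> 2 * v \<le> ?N \<and> F (2 * v) \<or>
        Suc (2 * v) \<le> ?N \<and> F (Suc (2 * v))" if v: "v \<in> {1..?N}" and Fv: "F v" for v
    proof -
      obtain x where x: "x \<in> X" "v \<in> anc (?P x)" "x \<in> ?Res" using Fv unfolding F_def by blast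
      have p: "?P x \<le> ?N" "arr \<sigma> aSlot (?P x) = x" using idx x(1) by (auto simp: indexed_def)
      have "?P x = v \<or> 2 * v \<in> anc (?P x) \<or> Suc (2 * v) \<in> anc (?P x)"
        using anc_children[of v "?P x"] x(2) v by auto
      then show ?thesis
      proof (elim disjE)
        assume "?P x = v" then show ?thesis using p x by auto
      next
        assume a: "2 * v \<in> anc (?P x)"
        then have "2 * v \<le> ?N" using anc_bounds[OF a] p by simp
        then show ?thesis using a x unfolding F_def by blast
      next
        assume a: "Suc (2 * v) \<in> anc (?P x)"
        then have "Suc (2 * v) \<le> ?N" using anc_bounds[OF a] p by simp
        then show ?thesis using a x unfolding F_def by blast
      qed
    qed
    have "wp U I (probe_code s) ?\<sigma>\<^sub>2 (\<lambda>m \<sigma>'. m \<le> 9 \<and> frame {rT, rL, rR} {} ?\<sigma>\<^sub>2 \<sigma>' \<and>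
      (reg \<sigma>' rL < reg \<sigma>' rR \<longleftrightarrow> probe I s S y (target s t S ?P 1)))"
    proof (rule wp_probe_code)
      have "node \<sigma> 1 = target s t S ?P 1" using tree by (auto simp: tree_ok_def)
      then show "qsets ?\<sigma>\<^sub>2 ! reg ?\<sigma>\<^sub>2 rI = target s t S ?P 1" by (simp add: node_def)
    qed (use inv2 yU tree in \<open>auto simp: ds_inv_def tree_ok_def\<close>)
    then show ?thesis
      unfolding search_code_def consts_code_def using y False
    proof (simp, elim wp_mono, goal_cases)
      case (1 m3 \<sigma>\<^sub>3)
      then have fr3: "frame {rT, rL, rR} {} ?\<sigma>\<^sub>2 \<sigma>\<^sub>3" and m3: "m3 \<le> 9" by auto
      note frD3 = frameD[OF fr3, simplified]
      have inv3: "ds_inv U s t S X \<sigma>\<^sub>3" by (rule ds_inv_frame[OF inv2 fr3]) auto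
      have iff: "reg \<sigma>\<^sub>3 rL < reg \<sigma>\<^sub>3 rR \<longleftrightarrow> F 1"
        using 1 probe_F[of 1] False by simp
      show ?case
      proof (cases "F 1")
        case no: False
        then have "?Res = {}" using F_root by simp
        then show ?thesis using no iff inv3 m3 frD3 by (simp add: find_answer_def)
      next
        case True
        let ?\<sigma>\<^sub>4 = "\<sigma>\<^sub>3\<lparr>reg := (reg \<sigma>\<^sub>3)(rV := 1, rG := 1)\<rparr>"
        have inv4: "ds_inv U s t S X ?\<sigma>\<^sub>4" using inv3 by simp
        have "wp U I (descend_code s) ?\<sigma>\<^sub>4 (\<lambda>m \<sigma>'.
          m \<le> Suc (bits (reg ?\<sigma>\<^sub>4 rN) * (2 * (reg ?\<sigma>\<^sub>4 rD * (2 * bits (reg ?\<sigma>\<^sub>4 rN) + 10)) + 40)) \<and>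
          frame {rI, rP, rX, rB, rT, rL, rR, rV, rG, rC} {} ?\<sigma>\<^sub>4 \<sigma>' \<and>
          arr ?\<sigma>\<^sub>4 aSlot (reg \<sigma>' rV) \<in> ?Res)"
          by (rule wp_descend_code[OF _ _ inv4 U, where F = F and y = y and Res = ?Res])
            (use inv4 U yU True False frD3 probe_F children in \<open>auto simp: True[simplified]\<close>)
        then show ?thesis using True iff
        proof (simp, elim wp_mono, goal_cases)
          case (1 m5 \<sigma>\<^sub>5)
          then have fr5: "frame {rI, rP, rX, rB, rT, rL, rR, rV, rG, rC} {} ?\<sigma>\<^sub>4 \<sigma>\<^sub>5" by simp
          note frD5 = frameD[OF fr5, simplified]
          have inv5: "ds_inv U s t S X \<sigma>\<^sub>5" by (rule ds_inv_frame[OF inv4 fr5]) auto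
          then show ?case using 1 m3 by (simp add: find_answer_def frD3 frD5)
        qed
      qed
    qed
  qed
qed

section \<open>Sessions\<close>

lemma oracle_extends_append: "oracle_extends U H H' \<Longrightarrow> \<exists>E. H' = H @ E"
  by (induction rule: oracle_extends.induct) auto

lemma ds_inv_load_args:
  "ds_inv U s t S X (load_args f \<sigma>) = ds_inv U s t S X \<sigma>"
  "reg (load_args f \<sigma>) rN = reg \<sigma> rN" "reg (load_args f \<sigma>) rD = reg \<sigma> rD"
  by (cases f; simp add: ds_inv_def maintains_def)+

lemma ds_inv_card:
  assumes "ds_inv U s t S X \<sigma>" "finite U"
  shows "reg \<sigma> rN = card X" "card X \<le> card U + 2" "real (bits (card X)) \<le> 2 * lg (card U)"
proof -
  have X: "X \<subseteq> U \<union> {s, t}" using assms(1) by (simp add: ds_inv_def)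
  show "reg \<sigma> rN = card X"
    using assms(1) indexed_card(2) by (auto simp: ds_inv_def)
  have "card X \<le> card (U \<union> {s, t})" using X assms(2) by (intro card_mono) auto
  also have "\<dots> \<le> card U + card {s, t}" by (rule card_Un_le)
  also have "card {s, t} \<le> 2" by (cases "s = t") auto
  finally show le: "card X \<le> card U + 2" by simp
  show "real (bits (card X)) \<le> 2 * lg (card U)"
    using bits_le_lg[OF le] lg_ge_1[of "card U"] by simp
qed

section \<open>Amortized accounting of updates\<close>

lemma total_update_time_snoc [simp]:
  "total_update_time (tr @ [(f, k, m)]) =
     total_update_time tr + (case f of Update ds \<Rightarrow> m | _ \<Rightarrow> 0)"
  by (simp add: total_update_time_def)

lemma total_update_budget_snoc [simp]:
  "total_update_budget \<beta> (tr @ [(f, k, m)]) =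
     total_update_budget \<beta> tr + (case f of
        Update ds \<Rightarrow> real k * real (length ds) / real \<beta> + (real (length ds) + 1) | _ \<Rightarrow> 0)"
  by (simp add: total_update_budget_def)

text \<open>The potential \<open>card X * |D| / \<beta>\<close>, where \<open>D\<close> is the log, pays for the next rebuilding; it does
  not increase when \<open>X\<close> shrinks.\<close>

lemma session_invariant:
  assumes M: "matroid U I" and U: "s \<notin> U" "t \<notin> U" and \<beta>: "1 \<le> \<beta>"
    and "session U I s t (exchange_structure \<beta> s t) S X \<sigma> tr"
  shows "S \<in> I \<and> ds_inv U s t S X \<sigma> \<and> reg \<sigma> rD < \<beta> \<and>
    real (total_update_time tr) +
      32 * lg (card U) * (real (card X) * real (reg \<sigma> rD) / real \<beta>) \<le>
    32 * lg (card U) * total_update_budget \<beta> tr"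
  using assms(5)
proof (induction rule: session.induct)
  case (start S q X xs H m \<sigma>)
  have "wp U I (initialize_code s t) (init_state S q xs H) (\<lambda>m \<sigma>'.
    m \<le> card X * (6 * bits (card X) + 24) + 11 \<and> ds_inv U s t S X \<sigma>' \<and> reg \<sigma>' rD = 0)"
    using start M by (intro wp_initialize_code) (auto simp: matroid_def)
  then show ?case
    using start \<beta> by (simp add: wp_exec exchange_structure_def total_update_time_def
        total_update_budget_def valid_init_def)
next
  case (caller S X \<sigma> tr H)
  have fr: "frame {} {} \<sigma> (\<sigma>\<lparr>qsets := H\<rparr>)"
    using oracle_extends_append[OF caller.hyps(2)] by (simp add: frame_def)
  have "ds_inv U s t S X (\<sigma>\<lparr>qsets := H\<rparr>)"
    using caller.IH by (intro ds_inv_frame[OF _ fr]) simp_all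
  then show ?case using caller.IH by simp
next
  case (operation S X \<sigma> tr f m \<sigma>')
  let ?L = "lg (card U)" let ?\<sigma> = "load_args f \<sigma>" let ?N = "card X"
  let ?bud = "total_update_budget \<beta> tr" let ?time = "real (total_update_time tr)"
  have fin: "finite U" using M by (simp add: matroid_def)
  have S: "S \<in> I" and inv: "ds_inv U s t S X ?\<sigma>" and rD: "reg \<sigma> rD < \<beta>"
    and pot: "?time + 32 * ?L * (real ?N * real (reg \<sigma> rD) / real \<beta>) \<le> 32 * ?L * ?bud"
    using operation.IH by (simp_all add: ds_inv_load_args)
  have L: "1 \<le> ?L" by (rule lg_ge_1)
  have finX: "finite X" using inv indexed_card(1) by (auto simp: ds_inv_def)
  note regs = ds_inv_load_args(2,3)[of f \<sigma>]
  note ex = operation.hyps(3)[unfolded exchange_structure_def]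
  show ?case
  proof (cases f)
    case (Find y)
    have "wp U I (search_code s) ?\<sigma> (\<lambda>m \<sigma>'. ds_inv U s t S X \<sigma>' \<and> reg \<sigma>' rD = reg \<sigma> rD)"
      by (rule wp_mono[OF wp_search_code[OF M S inv U, where y = y]])
        (use operation.hyps(2) Find in auto)
    \<comment> \<open>By determinism, the run recorded in the session is the one that satisfies the
      specification.\<close>
    then have "ds_inv U s t S X \<sigma>' \<and> reg \<sigma>' rD = reg \<sigma> rD"
      using ex by (simp add: Find wp_exec)
    then show ?thesis using S rD pot by (simp add: Find)
  next
    case (Delete x)
    have "wp U I (del_code s t) ?\<sigma> (\<lambda>m \<sigma>'. ds_inv U s t S (X - {x}) \<sigma>' \<and> reg \<sigma>' rD = reg \<sigma> rD)"
      by (rule wp_mono[OF wp_del_code[OF inv, where x = x]])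
        (use operation.hyps(2) Delete in auto)
    then have post: "ds_inv U s t S (X - {x}) \<sigma>'" "reg \<sigma>' rD = reg \<sigma> rD"
      using ex by (simp_all add: Delete wp_exec)
    have "card (X - {x}) \<le> ?N" using finX by (intro card_mono) auto
    then have "32 * ?L * (real (card (X - {x})) * real (reg \<sigma> rD) / real \<beta>)
        \<le> 32 * ?L * (real ?N * real (reg \<sigma> rD) / real \<beta>)"
      using L by (intro mult_left_mono divide_right_mono mult_right_mono) auto
    with pot post S rD show ?thesis by (simp add: Delete)
  next
    case (Replace x y)
    have xy: "x \<in> X" "y \<notin> X" "y \<in> U \<union> {s, t}" using operation.hyps(2) Replace by auto
    have "wp U I (repl_code s t) ?\<sigma>
        (\<lambda>m \<sigma>'. ds_inv U s t S (X - {x} \<union> {y}) \<sigma>' \<and> reg \<sigma>' rD = reg \<sigma> rD)"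
      by (rule wp_mono[OF wp_repl_code[OF inv, where x = x and y = y]])
        (use xy Replace in auto)
    then have post: "ds_inv U s t S (X - {x} \<union> {y}) \<sigma>'" "reg \<sigma>' rD = reg \<sigma> rD"
      using ex by (simp_all add: Replace wp_exec)
    have "card (X - {x} \<union> {y}) = Suc (card (X - {x}))"
      using xy finX by simp
    also have "\<dots> = ?N" using xy finX by (intro card_Suc_Diff1)
    finally show ?thesis using pot post S rD by (simp add: Replace)
  next
    case (Update ds)
    let ?n = "length ds" let ?d = "reg \<sigma>' rD" let ?S' = "sym_diff S (set ds - {s, t})"
    have ds: "distinct ds" "set ds \<subseteq> U \<union> {s, t}" "?S' \<in> I"
      using operation.hyps(2) Update by auto
    have N: "reg ?\<sigma> rN = ?N" "real (bits ?N) \<le> 2 * ?L"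
      using ds_inv_card[OF inv fin] by auto
    have "wp U I (upd_code \<beta> s t) ?\<sigma> (\<lambda>m \<sigma>'.
      ds_inv U s t ?S' X \<sigma>' \<and> reg \<sigma>' rN = reg ?\<sigma> rN \<and>
      (reg \<sigma>' rD \<le> reg ?\<sigma> rD + ?n \<and> reg \<sigma>' rD < \<beta> \<and> m \<le> 24 * ?n + 12 \<or>
       reg \<sigma>' rD = 0 \<and> \<beta> \<le> reg ?\<sigma> rD + ?n \<and>
       m \<le> 24 * ?n + 12 + reg ?\<sigma> rN * (6 * bits (reg ?\<sigma> rN) + 20)))"
      by (rule wp_upd_code[OF inv U ds(1,2)]) (simp_all add: Update)
    then have post: "ds_inv U s t ?S' X \<sigma>'"
      and cost: "?d \<le> reg \<sigma> rD + ?n \<and> ?d < \<beta> \<and> m \<le> 24 * ?n + 12 \<or>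
        ?d = 0 \<and> \<beta> \<le> reg \<sigma> rD + ?n \<and> m \<le> 24 * ?n + 12 + ?N * (6 * bits ?N + 20)"
      using ex by (simp_all only: Update op_code.simps data_structure.simps wp_exec
          N(1)[unfolded Update] regs(2)[unfolded Update])
    \<comment> \<open>The summand \<open>length ds + 1\<close> of the budget pays for reading and
      toggling.\<close>
    have n: "24 * real ?n + 12 \<le> 32 * ?L * (real ?n + 1)"
    proof -
      have "24 * real ?n + 12 \<le> 32 * (real ?n + 1)" by simp
      also have "\<dots> \<le> 32 * ?L * (real ?n + 1)" using L by (intro mult_right_mono) auto
      finally show ?thesis .
    qed
    \<comment> \<open>The amortized inequality: actual cost plus new potential is at most old
      potential plus the budget of this call.\<close>
    have "real m + 32 * ?L * (real ?N * real ?d / real \<beta>) \<le>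
      32 * ?L * (real ?N * real (reg \<sigma> rD) / real \<beta>) +
      32 * ?L * (real ?N * real ?n / real \<beta> + (real ?n + 1))"
      using cost
    proof (elim disjE conjE)
      assume d: "?d \<le> reg \<sigma> rD + ?n" "m \<le> 24 * ?n + 12"
      have "32 * ?L * (real ?N * real ?d / real \<beta>) \<le>
          32 * ?L * (real ?N * (real (reg \<sigma> rD) + real ?n) / real \<beta>)"
        using d(1) L by (intro mult_left_mono divide_right_mono) auto
      also have "\<dots> = 32 * ?L * (real ?N * real (reg \<sigma> rD) / real \<beta>) +
          32 * ?L * (real ?N * real ?n / real \<beta>)"
        by (simp add: algebra_simps add_divide_distrib)
      finally have "32 * ?L * (real ?N * real ?d / real \<beta>) \<le> \<dots>" .
      moreover have "real m \<le> 24 * real ?n + 12" using d(2) by linarith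
      ultimately show ?thesis using n by (simp add: distrib_left)
    next
      assume d: "?d = 0" "\<beta> \<le> reg \<sigma> rD + ?n" "m \<le> 24 * ?n + 12 + ?N * (6 * bits ?N + 20)"
      have "real m \<le> real (24 * ?n + 12 + ?N * (6 * bits ?N + 20))" using d(3) of_nat_le_iff by blast
      also have "\<dots> = (24 * real ?n + 12) + real ?N * (6 * real (bits ?N) + 20)" by simp
      \<comment> \<open>Origin of the factor 32: \<open>6 * bits ?N + 20\<close> is at most
        \<open>12 * ?L + 20\<close>, and \<open>?L\<close> is at least 1.\<close>
      also have "\<dots> \<le> (24 * real ?n + 12) + real ?N * (32 * ?L)"
        using N(2) L by (intro add_left_mono mult_left_mono) auto
      finally have m: "real m \<le> 32 * ?L * (real ?n + 1) + 32 * ?L * real ?N"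
        using n by (simp add: algebra_simps)
      \<comment> \<open>A rebuilding needs \<open>\<beta>\<close> log entries, each worth
        \<open>card X / \<beta>\<close> up to the common factor. The old potential and the share of
        the new entries together therefore cover the whole heap.\<close>
      have "real \<beta> \<le> real (reg \<sigma> rD) + real ?n" using d(2) by linarith
      then have "real ?N * real \<beta> / real \<beta> \<le> real ?N * (real (reg \<sigma> rD) + real ?n) / real \<beta>"
        by (intro divide_right_mono mult_left_mono) auto
      then have "32 * ?L * real ?N \<le> 32 * ?L * (real ?N * (real (reg \<sigma> rD) + real ?n) / real \<beta>)"
        using \<beta> L by (intro mult_left_mono) auto
      also have "\<dots> = 32 * ?L * (real ?N * real (reg \<sigma> rD) / real \<beta>) +
          32 * ?L * (real ?N * real ?n / real \<beta>)"
        by (simp add: algebra_simps add_divide_distrib)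
      finally show ?thesis using m d(1) by (simp add: distrib_left)
    qed
    moreover have "?d < \<beta>" using cost \<beta> by auto
    ultimately show ?thesis
      using post ds(3) pot by (simp add: Update distrib_left)
  qed
qed

section \<open>Worst-case and amortized time bounds\<close>

theorem theorem4p1:
  shows "\<exists>(C::real) (c::nat). \<forall>(\<beta>::nat) (s::nat) (t::nat). \<beta> \<ge> 1 \<and> s \<noteq> t \<longrightarrow>
    (\<exists>D::data_structure. \<forall>(U::nat set) (I::nat set set).
       matroid U I \<and> s \<notin> U \<and> t \<notin> U \<longrightarrow>
       (\<forall>S q X xs H. valid_init U I t S q X xs H \<longrightarrow>
          (\<exists>m \<sigma>. exec U I (init_code D) (init_state S q xs H) m \<sigma> \<and>
             real m \<le> C * lg (card U) ^ c * (real (card X) + 1))) \<and>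
       (\<forall>S X \<sigma> tr. session U I s t D S X \<sigma> tr \<longrightarrow>
          maintains S \<sigma> \<and>
          (\<forall>y. valid_op U I s t S X (Find y) \<longrightarrow>
             (\<exists>m \<sigma>'. exec U I (find_code D) (load_args (Find y) \<sigma>) m \<sigma>' \<and>
                (case find_answer \<sigma>' of
                   None \<Rightarrow> find_results I s t S X y = {} \<and>
                           real m \<le> C * lg (card U) ^ c
                 | Some x \<Rightarrow> x \<in> find_results I s t S X y \<and>
                           real m \<le> C * lg (card U) ^ c * real \<beta>))) \<and>
          (\<forall>x. valid_op U I s t S X (Delete x) \<longrightarrow>
             (\<exists>m \<sigma>'. exec U I (delete_code D) (load_args (Delete x) \<sigma>) m \<sigma>' \<and>
                real m \<le> C * lg (card U))) \<and>
          (\<forall>x y. valid_op U I s t S X (Replace x y) \<longrightarrow>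
             (\<exists>m \<sigma>'. exec U I (replace_code D) (load_args (Replace x y) \<sigma>) m \<sigma>' \<and>
                real m \<le> C * lg (card U))) \<and>
          (\<forall>ds. valid_op U I s t S X (Update ds) \<longrightarrow>
             (\<exists>m \<sigma>'. exec U I (update_code D) (load_args (Update ds) \<sigma>) m \<sigma>')) \<and>
          real (total_update_time tr) \<le> C * lg (card U) ^ c * total_update_budget \<beta> tr))"
proof (rule exI[of _ 200], rule exI[of _ 2], intro allI impI, elim conjE)
  fix \<beta> s t :: nat
  assume \<beta>: "1 \<le> \<beta>"
  \<comment> \<open>The structure is fixed by \<open>\<beta>\<close>, \<open>s\<close> and
    \<open>t\<close> alone, before the matroid is given. The constant 200 is rounded up; the most
    expensive operation is a successful \<open>Find\<close>, for which 161 suffices.\<close>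
  let ?D = "exchange_structure \<beta> s t"
  show "\<exists>D::data_structure. \<forall>(U::nat set) (I::nat set set).
       matroid U I \<and> s \<notin> U \<and> t \<notin> U \<longrightarrow>
       (\<forall>S q X xs H. valid_init U I t S q X xs H \<longrightarrow>
          (\<exists>m \<sigma>. exec U I (init_code D) (init_state S q xs H) m \<sigma> \<and>
             real m \<le> 200 * lg (card U) ^ 2 * (real (card X) + 1))) \<and>
       (\<forall>S X \<sigma> tr. session U I s t D S X \<sigma> tr \<longrightarrow>
          maintains S \<sigma> \<and>
          (\<forall>y. valid_op U I s t S X (Find y) \<longrightarrow>
             (\<exists>m \<sigma>'. exec U I (find_code D) (load_args (Find y) \<sigma>) m \<sigma>' \<and>
                (case find_answer \<sigma>' of
                   None \<Rightarrow> find_results I s t S X y = {} \<and>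
                           real m \<le> 200 * lg (card U) ^ 2
                 | Some x \<Rightarrow> x \<in> find_results I s t S X y \<and>
                           real m \<le> 200 * lg (card U) ^ 2 * real \<beta>))) \<and>
          (\<forall>x. valid_op U I s t S X (Delete x) \<longrightarrow>
             (\<exists>m \<sigma>'. exec U I (delete_code D) (load_args (Delete x) \<sigma>) m \<sigma>' \<and>
                real m \<le> 200 * lg (card U))) \<and>
          (\<forall>x y. valid_op U I s t S X (Replace x y) \<longrightarrow>
             (\<exists>m \<sigma>'. exec U I (replace_code D) (load_args (Replace x y) \<sigma>) m \<sigma>' \<and>
                real m \<le> 200 * lg (card U))) \<and>
          (\<forall>ds. valid_op U I s t S X (Update ds) \<longrightarrow>
             (\<exists>m \<sigma>'. exec U I (update_code D) (load_args (Update ds) \<sigma>) m \<sigma>')) \<and>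
          real (total_update_time tr) \<le> 200 * lg (card U) ^ 2 * total_update_budget \<beta> tr)"
  proof (intro exI[of _ ?D] allI impI conjI; (elim conjE)?)
    fix U :: "nat set" and I :: "nat set set"
    assume M: "matroid U I" and U: "s \<notin> U" "t \<notin> U"
    let ?L = "lg (card U)"
    have fin: "finite U" and I: "I \<subseteq> Pow U" using M by (auto simp: matroid_def)
    have L: "1 \<le> ?L" "?L \<le> ?L ^ 2" "1 \<le> ?L ^ 2"
      using lg_ge_1[of "card U"] by (auto simp: power2_eq_square intro: mult_ge1_I)
    {
      fix S q X xs H
      assume init: "valid_init U I t S q X xs H"
      let ?N = "card X"
      have "wp U I (initialize_code s t) (init_state S q xs H) (\<lambda>m \<sigma>'.
        m \<le> ?N * (6 * bits ?N + 24) + 11 \<and> ds_inv U s t S X \<sigma>' \<and> reg \<sigma>' rD = 0)"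
        by (rule wp_initialize_code[OF init I])
      then obtain m \<sigma> where ex: "exec U I (initialize_code s t) (init_state S q xs H) m \<sigma>"
        and m: "m \<le> ?N * (6 * bits ?N + 24) + 11" and inv: "ds_inv U s t S X \<sigma>"
        unfolding wp_def by blast
      have "real m \<le> real (?N * (6 * bits ?N + 24) + 11)" using m of_nat_le_iff by blast
      also have "\<dots> = real ?N * (6 * real (bits ?N) + 24) + 11" by simp
      also have "\<dots> \<le> real ?N * (200 * ?L ^ 2) + 200 * ?L ^ 2"
        using ds_inv_card(3)[OF inv fin] L by (intro add_mono mult_left_mono) auto
      also have "\<dots> = 200 * ?L ^ 2 * (real ?N + 1)" by (simp add: algebra_simps)
      finally show "\<exists>m \<sigma>. exec U I (init_code ?D) (init_state S q xs H) m \<sigma> \<and>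
             real m \<le> 200 * ?L ^ 2 * (real ?N + 1)"
        using ex by (auto simp: exchange_structure_def)
    }
    fix S X \<sigma> tr
    assume "session U I s t ?D S X \<sigma> tr"
    from session_invariant[OF M U \<beta> this]
    have S: "S \<in> I" and inv: "ds_inv U s t S X \<sigma>" and rD: "reg \<sigma> rD < \<beta>"
      and pot: "real (total_update_time tr) +
        32 * ?L * (real (card X) * real (reg \<sigma> rD) / real \<beta>) \<le> 32 * ?L * total_update_budget \<beta> tr"
      by auto
    have inv': "ds_inv U s t S X (load_args f \<sigma>)" for f using inv by (simp add: ds_inv_load_args)
    note N = ds_inv_card[OF inv fin]
    show "maintains S \<sigma>" using inv by (simp add: ds_inv_def)
    {
      fix y assume op: "valid_op U I s t S X (Find y)"
      let ?b = "bits (card X)"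
      let ?t = "?b * (2 * (reg \<sigma> rD * (2 * ?b + 10)) + 40) + 25"
      have "wp U I (search_code s) (load_args (Find y) \<sigma>) (\<lambda>m \<sigma>'.
        case find_answer \<sigma>' of None \<Rightarrow> find_results I s t S X y = {} \<and> m \<le> 20
         | Some x \<Rightarrow> x \<in> find_results I s t S X y \<and> m \<le> ?t)"
        by (rule wp_mono[OF wp_search_code[OF M S inv' U _ op]])
          (use N(1) in \<open>auto simp: ds_inv_load_args split: option.splits\<close>)
      then obtain m \<sigma>' where ex: "exec U I (search_code s) (load_args (Find y) \<sigma>) m \<sigma>'"
        and res: "case find_answer \<sigma>' of None \<Rightarrow> find_results I s t S X y = {} \<and> m \<le> 20
          | Some x \<Rightarrow> x \<in> find_results I s t S X y \<and> m \<le> ?t"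
        unfolding wp_def by blast
      have t: "real ?t \<le> 200 * ?L ^ 2 * real \<beta>"
      proof -
        have b: "real ?b \<le> 2 * ?L" by (rule N(3))
        have "real ?t = real ?b * (2 * (real (reg \<sigma> rD) * (2 * real ?b + 10)) + 40) + 25" by simp
        \<comment> \<open>Here \<open>2 * bits + 10\<close> is at most \<open>14 * ?L\<close>, and
          the additive constants are absorbed by products with \<open>\<beta>\<close> and
          \<open>?L\<close> that are at least 1. The total is
          \<open>2 * (28 + 40) + 25 = 161\<close>.\<close>
        also have "\<dots> \<le> (2 * ?L) * (2 * (real \<beta> * (14 * ?L)) + 40 * (real \<beta> * ?L)) + 25 * (?L ^ 2 * real \<beta>)"
        proof (intro add_mono mult_mono mult_left_mono)
          have "1 * 1 \<le> real \<beta> * ?L" using \<beta> L(1) by (intro mult_mono) auto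
          then show "40 \<le> 40 * (real \<beta> * ?L)" by simp
          have "1 * 1 \<le> ?L ^ 2 * real \<beta>" using \<beta> L(3) by (intro mult_mono) auto
          then show "25 \<le> 25 * (?L ^ 2 * real \<beta>)" by simp
        qed (use b L \<beta> rD in auto)
        also have "\<dots> = 161 * ?L ^ 2 * real \<beta>" by (simp add: algebra_simps power2_eq_square)
        also have "\<dots> \<le> 200 * ?L ^ 2 * real \<beta>" by (intro mult_right_mono) auto
        finally show ?thesis .
      qed
      have "case find_answer \<sigma>' of
             None \<Rightarrow> find_results I s t S X y = {} \<and> real m \<le> 200 * ?L ^ 2
           | Some x \<Rightarrow> x \<in> find_results I s t S X y \<and> real m \<le> 200 * ?L ^ 2 * real \<beta>"
      proof (cases "find_answer \<sigma>'")
        case None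
        then show ?thesis using res L by auto
      next
        case (Some x)
        then have "real m \<le> real ?t" using res by (simp only: option.case of_nat_le_iff)
        with t have "real m \<le> 200 * ?L ^ 2 * real \<beta>" by (rule order_trans[rotated])
        then show ?thesis using res Some by simp
      qed
      then show "\<exists>m \<sigma>'. exec U I (find_code ?D) (load_args (Find y) \<sigma>) m \<sigma>' \<and>
          (case find_answer \<sigma>' of
             None \<Rightarrow> find_results I s t S X y = {} \<and> real m \<le> 200 * ?L ^ 2
           | Some x \<Rightarrow> x \<in> find_results I s t S X y \<and> real m \<le> 200 * ?L ^ 2 * real \<beta>)"
        using ex by (auto simp: exchange_structure_def)
    next
      fix x assume op: "valid_op U I s t S X (Delete x)"
      have "wp U I (del_code s t) (load_args (Delete x) \<sigma>) (\<lambda>m \<sigma>'. m \<le> 18 * bits (card X) + 50)"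
        by (rule wp_mono[OF wp_del_code[OF inv', where x = x]])
          (use op N(1) in \<open>auto simp: ds_inv_load_args\<close>)
      then obtain m \<sigma>' where "exec U I (del_code s t) (load_args (Delete x) \<sigma>) m \<sigma>'"
        and m: "m \<le> 18 * bits (card X) + 50"
        unfolding wp_def by blast
      moreover have "real m \<le> 200 * ?L" using m N(3) L(1) by linarith
      ultimately show "\<exists>m \<sigma>'. exec U I (delete_code ?D) (load_args (Delete x) \<sigma>) m \<sigma>' \<and>
          real m \<le> 200 * ?L"
        by (auto simp: exchange_structure_def)
    next
      fix x y assume op: "valid_op U I s t S X (Replace x y)"
      have "wp U I (repl_code s t) (load_args (Replace x y) \<sigma>) (\<lambda>m \<sigma>'. m \<le> 12 * bits (card X) + 40)"
        by (rule wp_mono[OF wp_repl_code[OF inv', where x = x and y = y]])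
          (use op N(1) in \<open>auto simp: ds_inv_load_args\<close>)
      then obtain m \<sigma>' where "exec U I (repl_code s t) (load_args (Replace x y) \<sigma>) m \<sigma>'"
        and m: "m \<le> 12 * bits (card X) + 40"
        unfolding wp_def by blast
      moreover have "real m \<le> 200 * ?L" using m N(3) L(1) by linarith
      ultimately show "\<exists>m \<sigma>'. exec U I (replace_code ?D) (load_args (Replace x y) \<sigma>) m \<sigma>' \<and>
          real m \<le> 200 * ?L"
        by (auto simp: exchange_structure_def)
    next
      fix ds assume op: "valid_op U I s t S X (Update ds)"
      have "wp U I (upd_code \<beta> s t) (load_args (Update ds) \<sigma>) (\<lambda>m \<sigma>'. True)"
        by (rule wp_mono[OF wp_upd_code[OF inv' U, where ds = ds]]) (use op in auto)
      then show "\<exists>m \<sigma>'. exec U I (update_code ?D) (load_args (Update ds) \<sigma>) m \<sigma>'"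
        unfolding wp_def by (auto simp: exchange_structure_def)
    }
    \<comment> \<open>The sign of the budget permits raising its factor from \<open>32 * ?L\<close>
      to \<open>200 * ?L ^ 2\<close>; the potential is nonnegative and is dropped.\<close>
    have "0 \<le> total_update_budget \<beta> tr"
      unfolding total_update_budget_def
      by (intro sum_list_nonneg) (auto split: operation.splits)
    then have "32 * ?L * total_update_budget \<beta> tr \<le> 200 * ?L ^ 2 * total_update_budget \<beta> tr"
      using L by (intro mult_right_mono mult_mono) auto
    moreover have "0 \<le> 32 * ?L * (real (card X) * real (reg \<sigma> rD) / real \<beta>)"
      using L by simp
    ultimately show "real (total_update_time tr) \<le> 200 * ?L ^ 2 * total_update_budget \<beta> tr"
      using pot by linarith
  qed
qed

end
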